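(* Let $G\in\mathcal{G}_I^0$, $\Psi\in\mathcal{G}_I^0$, put $\psi=z\Psi_z$, and let $\lambda$ be a nonzero finite Borel measure on $\mathbb{S}^n$. Assume: (i) $d\lambda(\xi)=p_\lambda(\xi)\,d\xi$, where the function $p_\lambda:\mathbb{S}^n\to(0,\infty)$ is continuous; (ii) for all $x\in\mathbb{S}^n$, $\lim_{s\to+\infty}\Psi(s,x)=+\infty$. Let $\mu$ be a nonzero finite Borel measure on $\mathbb{S}^n$ that is not concentrated on any closed hemisphere. Then there is a convex body $\Omega\in\mathcal{K}$ such that $$\psi(u_\Omega(\cdot),\cdot)\,d\mu=\tau\,d\widetilde{C}_{G,\lambda}(\Omega,\cdot)$$ as measures on $\mathbb{S}^n$, with the constant $$\tau=\frac{1}{\widetilde{C}_{G,\lambda}(\Omega,\mathbb{S}^n)}\int_{\mathbb{S}^n}\psi(u_\Omega(x),x)\,d\mu(x).$$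
   Context: $\mathbb{S}^n$ is the unit sphere of $\mathbb{R}^{n+1}$, $d\xi$ is the usual spherical measure on it, and $o$ is the origin. A convex body is a compact convex set in $\mathbb{R}^{n+1}$ with nonempty interior. $\mathcal{K}$ is the set of all convex bodies containing $o$ (possibly on the boundary). $\mathcal{G}_I^0$ is the class of continuous functions $G:[0,\infty)\times\mathbb{S}^n\to[0,\infty)$ such that (with $G_z$ the partial derivative in the first variable $z$): $zG_z(z,\xi)$ is continuous on $[0,\infty)\times\mathbb{S}^n$; $G_z>0$ on $(0,\infty)\times\mathbb{S}^n$; and $G(0,\xi)=0$ and $zG_z(z,\xi)=0$ at $z=0$ for all $\xi\in\mathbb{S}^n$. For $\Psi\in\mathcal{G}_I^0$, $\psi=z\Psi_z:[0,\infty)\times\mathbb{S}^n\to[0,\infty)$, with $\psi(0,\xi)=\lim_{z\to0^+}\psi(z,\xi)$. For $\Omega\in\mathcal{K}$: radial function $r_\Omega(x)=\max\{a\in\mathbb{R}:ax\in\Omega\}$ and support function $u_\Omega(x)=\max\{\langle x,y\rangle:y\in\Omega\}$ for $x\in\mathbb{S}^n$. The reverse Gauss map is $\nu_\Omega^{-1}(x)=\{y\in\partial\Omega:\langle x,y\rangle=u_\Omega(x)\}$ and $\nu_\Omega^{-1}(E)=\bigcup_{x\in E}\nu_\Omega^{-1}(x)$. The reverse radial Gauss image is $\alpha_\Omega^*(E)=\{\xi\in\mathbb{S}^n:r_\Omega(\xi)\xi\in\nu_\Omega^{-1}(E)\}$ for $E\subseteq\mathbb{S}^n$ Borel. The normal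 cone of $\Omega$ at $o$ is $N(\Omega,o)=\{y\in\mathbb{R}^{n+1}:\langle\tilde y,y\rangle\le0\text{ for all }\tilde y\in\Omega\}$. For Borel $\omega\subseteq\mathbb{S}^n$, $$\widetilde{C}_{G,\lambda}(\Omega,\omega)=\int_{\alpha_\Omega^*(\omega\setminus N(\Omega,o))}r_\Omega(\xi)G_z(r_\Omega(\xi),\xi)\,d\lambda(\xi),$$ where $zG_z(z,\xi)$ is understood to be $0$ at $z=0$. *)

theory Defs
  imports "HOL-Analysis.Analysis"
begin

text \<open>The space \<open>\<real>\<^bsup>n+1\<^esup>\<close> is a Euclidean space type \<^typ>\<open>'a\<close> with \<open>n + 1 = DIM('a)\<close>,
  and the unit sphere is \<^term>\<open>sphere 0 1\<close>. A function on \<open>[0,\<infinity>) \<times> S\<^sup>n\<close> is a total function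
  \<open>real \<Rightarrow> 'a \<Rightarrow> real\<close> of which only the values on that set matter.\<close>

abbreviation sphere_borel :: "'a::euclidean_space measure" where
  "sphere_borel \<equiv> restrict_space borel (sphere 0 1)"

definition finite_borel_measure_on_sphere :: "'a::euclidean_space measure \<Rightarrow> bool" where
  "finite_borel_measure_on_sphere \<mu> \<longleftrightarrow> sets \<mu> = sets sphere_borel \<and> finite_measure \<mu>"

text \<open>The usual spherical measure, given by polar coordinates: \<open>E\<close> has measure \<open>n + 1\<close> times the
  Lebesgue measure of the cone \<open>{t \<xi> | 0 < t \<le> 1, \<xi> \<in> E}\<close>. Here \<^term>\<open>sgn x\<close> is
  \<open>x / |x|\<close>.\<close>

definition spherical_measure :: "'a::euclidean_space measure" where
  "spherical_measure =
     scale_measure (of_nat DIM('a))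
       (distr (restrict_space lborel (cball (0::'a) 1 - {0})) sphere_borel sgn)"

lemma emeasure_spherical_measure:
  assumes "E \<in> sets (sphere_borel :: 'a::euclidean_space measure)"
  shows "emeasure spherical_measure E =
    of_nat DIM('a) * emeasure lborel {x \<in> cball (0::'a) 1 - {0}. sgn x \<in> E}"
proof -
  have "(sgn :: 'a \<Rightarrow> 'a) \<in> borel_measurable borel"
    unfolding sgn_div_norm by measurable
  then have meas: "(sgn :: 'a \<Rightarrow> 'a) \<in>
      measurable (restrict_space lborel (cball 0 1 - {0})) sphere_borel"
    by (intro measurable_restrict_space2 measurable_restrict_space1)
      (auto simp: space_restrict_space norm_sgn)
  have "sgn -` E \<inter> (cball (0::'a) 1 - {0}) = {x \<in> cball (0::'a) 1 - {0}. sgn x \<in> E}"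
    by auto
  moreover have "emeasure (restrict_space lborel (cball (0::'a) 1 - {0})) C = emeasure lborel C"
    if "C \<subseteq> cball 0 1 - {0}" for C
    using that by (intro emeasure_restrict_space) simp_all
  moreover have "emeasure (spherical_measure :: 'a measure) E = of_nat DIM('a) *
      emeasure (restrict_space lborel (cball 0 1 - {0})) (sgn -` E \<inter> (cball (0::'a) 1 - {0}))"
    unfolding spherical_measure_def emeasure_scale_measure emeasure_distr[OF meas assms]
    by (simp add: space_restrict_space)
  ultimately show ?thesis
    by (metis inf_le2)
qed

definition concentrated_on_closed_hemisphere :: "'a::euclidean_space measure \<Rightarrow> bool" where
  "concentrated_on_closed_hemisphere \<mu> \<longleftrightarrow>
     (\<exists>v \<in> sphere 0 1. emeasure \<mu> (sphere 0 1 - {x \<in> sphere 0 1. v \<bullet> x \<ge> 0}) = 0)"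

text \<open>\<open>z G\<^sub>z(z,\<xi>)\<close>. At \<open>z = 0\<close> the factor \<open>z\<close> makes this \<open>0\<close>, whatever
  value \<^const>\<open>deriv\<close> has there.\<close>

definition z_deriv :: "(real \<Rightarrow> 'a \<Rightarrow> real) \<Rightarrow> real \<Rightarrow> 'a \<Rightarrow> real" where
  "z_deriv G z \<xi> = z * deriv (\<lambda>s. G s \<xi>) z"

text \<open>As \<open>z_deriv G 0 \<xi> = 0\<close>, its continuity on \<open>[0,\<infinity>) \<times> S\<^sup>n\<close> also says that
  \<open>z G\<^sub>z(z,\<xi>)\<close> tends to \<open>0\<close> as \<open>z \<rightarrow> 0+\<close>, so the value of \<open>z G\<^sub>z\<close> at \<open>0\<close> is
  the limit from the right.\<close>

definition class_GI0 :: "(real \<Rightarrow> 'a::euclidean_space \<Rightarrow> real) set" where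
  "class_GI0 = {G.
     continuous_on ({0..} \<times> sphere 0 1) (\<lambda>(z, \<xi>). G z \<xi>) \<and>
     (\<forall>z \<ge> 0. \<forall>\<xi> \<in> sphere 0 1. G z \<xi> \<ge> 0) \<and>
     (\<forall>z > 0. \<forall>\<xi> \<in> sphere 0 1. (\<lambda>s. G s \<xi>) differentiable (at z)) \<and>
     continuous_on ({0..} \<times> sphere 0 1) (\<lambda>(z, \<xi>). z_deriv G z \<xi>) \<and>
     (\<forall>z > 0. \<forall>\<xi> \<in> sphere 0 1. deriv (\<lambda>s. G s \<xi>) z > 0) \<and>
     (\<forall>\<xi> \<in> sphere 0 1. G 0 \<xi> = 0 \<and> z_deriv G 0 \<xi> = 0)}"

definition convex_body :: "'a::euclidean_space set \<Rightarrow> bool" where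
  "convex_body \<Omega> \<longleftrightarrow> compact \<Omega> \<and> convex \<Omega> \<and> interior \<Omega> \<noteq> {}"

definition bodies_with_origin :: "'a::euclidean_space set set" where
  "bodies_with_origin = {\<Omega>. convex_body \<Omega> \<and> 0 \<in> \<Omega>}"

text \<open>The suprema in the next two definitions are maxima for the bodies considered here, see
  \<open>radial_function_attained\<close> and \<open>support_function_attained\<close> below.\<close>

definition radial_function :: "'a::euclidean_space set \<Rightarrow> 'a \<Rightarrow> real" where
  "radial_function \<Omega> x = Sup {a. a *\<^sub>R x \<in> \<Omega>}"

definition support_function :: "'a::euclidean_space set \<Rightarrow> 'a \<Rightarrow> real" where
  "support_function \<Omega> x = (SUP y\<in>\<Omega>. x \<bullet> y)"

lemma radial_function_attained:
  assumes "\<Omega> \<in> bodies_with_origin" and "x \<in> sphere 0 1"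
  shows "radial_function \<Omega> x *\<^sub>R x \<in> \<Omega>"
    and "a *\<^sub>R x \<in> \<Omega> \<Longrightarrow> a \<le> radial_function \<Omega> x"
proof -
  let ?A = "{a. a *\<^sub>R x \<in> \<Omega>}"
  have "compact \<Omega>" "0 \<in> \<Omega>"
    using assms by (auto simp: bodies_with_origin_def convex_body_def)
  have norm_x: "norm x = 1"
    using assms by simp
  obtain B where B: "\<And>y. y \<in> \<Omega> \<Longrightarrow> norm y \<le> B"
    using compact_imp_bounded[OF \<open>compact \<Omega>\<close>] unfolding bounded_iff by blast
  have le_B: "a \<le> B" if "a \<in> ?A" for a
    using B[of "a *\<^sub>R x"] that norm_x by simp
  then have bdd: "bdd_above ?A"
    by (rule bdd_aboveI)
  have "closed ((\<lambda>a. a *\<^sub>R x) -` \<Omega>)"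
    by (rule continuous_closed_vimage[OF compact_imp_closed[OF \<open>compact \<Omega>\<close>]])
      (simp add: isCont_scaleR)
  then have "closed ?A"
    by (simp add: vimage_def)
  moreover have "?A \<noteq> {}"
  proof -
    have "0 \<in> ?A"
      using \<open>0 \<in> \<Omega>\<close> by simp
    then show ?thesis
      by blast
  qed
  ultimately have "Sup ?A \<in> ?A"
    using bdd by (intro closed_contains_Sup)
  then show "radial_function \<Omega> x *\<^sub>R x \<in> \<Omega>"
    by (simp add: radial_function_def)
  show "a *\<^sub>R x \<in> \<Omega> \<Longrightarrow> a \<le> radial_function \<Omega> x"
    unfolding radial_function_def by (rule cSup_upper[OF _ bdd]) simp
qed

lemma support_function_attained:
  assumes "\<Omega> \<in> bodies_with_origin"
  shows "\<exists>y \<in> \<Omega>. x \<bullet> y = support_function \<Omega> x"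
    and "y \<in> \<Omega> \<Longrightarrow> x \<bullet> y \<le> support_function \<Omega> x"
proof -
  have "compact \<Omega>" "0 \<in> \<Omega>"
    using assms by (auto simp: bodies_with_origin_def convex_body_def)
  have cpt: "compact ((\<lambda>y. x \<bullet> y) ` \<Omega>)"
    by (rule compact_continuous_image[OF _ \<open>compact \<Omega>\<close>]) (intro continuous_intros)
  have ne: "(\<lambda>y. x \<bullet> y) ` \<Omega> \<noteq> {}"
    using \<open>0 \<in> \<Omega>\<close> by blast
  have bdd: "bdd_above ((\<lambda>y. x \<bullet> y) ` \<Omega>)"
    using cpt by (intro bounded_imp_bdd_above compact_imp_bounded)
  show "\<exists>y \<in> \<Omega>. x \<bullet> y = support_function \<Omega> x"
    using closed_contains_Sup[OF ne bdd compact_imp_closed[OF cpt]]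
    unfolding support_function_def image_iff by metis
  show "y \<in> \<Omega> \<Longrightarrow> x \<bullet> y \<le> support_function \<Omega> x"
    unfolding support_function_def by (rule cSUP_upper[OF _ bdd])
qed

definition reverse_gauss_point :: "'a::euclidean_space set \<Rightarrow> 'a \<Rightarrow> 'a set" where
  "reverse_gauss_point \<Omega> x = {y \<in> frontier \<Omega>. x \<bullet> y = support_function \<Omega> x}"

definition reverse_gauss :: "'a::euclidean_space set \<Rightarrow> 'a set \<Rightarrow> 'a set" where
  "reverse_gauss \<Omega> E = (\<Union>x\<in>E. reverse_gauss_point \<Omega> x)"

definition reverse_radial_gauss :: "'a::euclidean_space set \<Rightarrow> 'a set \<Rightarrow> 'a set" where
  "reverse_radial_gauss \<Omega> E =
     {\<xi> \<in> sphere 0 1. radial_function \<Omega> \<xi> *\<^sub>R \<xi> \<in> reverse_gauss \<Omega> E}"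

definition normal_cone_at_origin :: "'a::euclidean_space set \<Rightarrow> 'a set" where
  "normal_cone_at_origin \<Omega> = {y. \<forall>y' \<in> \<Omega>. y' \<bullet> y \<le> 0}"

text \<open>For Borel \<open>\<omega>\<close> the domain of integration is Borel only up to a null set of the spherical
  measure, hence the completion of \<open>\<kappa>\<close>.\<close>

definition dual_curvature ::
  "(real \<Rightarrow> 'a::euclidean_space \<Rightarrow> real) \<Rightarrow> 'a measure \<Rightarrow> 'a set \<Rightarrow> 'a set \<Rightarrow> ennreal" where
  "dual_curvature G \<kappa> \<Omega> \<omega> =
     (\<integral>\<^sup>+ \<xi> \<in> reverse_radial_gauss \<Omega> (\<omega> - normal_cone_at_origin \<Omega>).
        ennreal (z_deriv G (radial_function \<Omega> \<xi>) \<xi>) \<partial>completion \<kappa>)"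

end

theory Submission
  imports Defs "HOL-Complex_Analysis.Great_Picard"
begin

text \<open>The body is found by minimization. Among the compact convex sets that contain the origin and whose
dual volume \<open>\<integral> G(r\<^sub>\<Omega>(\<xi>), \<xi>) d\<kappa>\<close> is at least that of the unit ball, let \<open>\<Omega>\<close> be one of least
energy \<open>\<integral> \<Psi>(u\<^sub>\<Omega>(x), x) d\<mu>\<close>. The asserted equation is the Euler-Lagrange equation of this problem, with
\<open>\<tau>\<close> as Lagrange multiplier.

A minimizer exists (\<open>exists_energy_minimizer\<close>) for three reasons. Bodies of bounded energy are uniformly
bounded, because \<open>\<Psi>\<close> tends to infinity and \<open>\<mu>\<close> gives positive mass to every open hemisphere
(\<open>energy_coercive\<close>). Hence the support functions of a minimizing sequence are uniformly Lipschitz and, after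
passing to a subsequence, converge uniformly to a function \<open>g\<close>. The Wulff shape of \<open>g\<close>, which is the
intersection of the half-spaces \<open>{y. x \<bullet> y \<le> g x}\<close>, is the limit body (\<open>limit_body\<close>): its support function is
at most \<open>g\<close>, so no energy is gained, and its radial function is at least the upper limit of the radial
functions, so no dual volume is lost. A body of positive dual volume has interior points, since the
radial function of a subset of a hyperplane vanishes in almost every direction.

The minimizer \<open>\<Omega>\<close>, with support function \<open>u\<close> and radial function \<open>r\<close>, may have the origin on its
boundary, so that \<open>u\<close> has zeros. It is therefore varied multiplicatively: \<open>\<Omega>\<^sub>t\<close> is the Wulff shape of
\<open>u(x) exp (t \<phi>(x))\<close>, which contains the origin for every continuous \<open>\<phi>\<close> of either sign, and whose
support function is at most \<open>u exp (t \<phi>)\<close>. For almost every \<open>\<xi>\<close> with \<open>r(\<xi>) > 0\<close> there is exactly one unit normal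
\<open>\<alpha>(\<xi>)\<close> at the boundary point \<open>r(\<xi>) \<xi>\<close>, and \<open>u(\<alpha>(\<xi>)) > 0\<close> (\<open>AE_unique_normal\<close>); there the logarithm of
the radial function of \<open>\<Omega>\<^sub>t\<close> has the right derivative \<open>\<phi>(\<alpha>(\<xi>))\<close> at \<open>t = 0\<close> (\<open>log_rate_tendsto\<close>). By
dominated convergence the dual volume of \<open>\<Omega>\<^sub>t\<close> and the bound \<open>\<integral> \<Psi>(u(x) exp (t \<phi>(x)), x) d\<mu>\<close> on its energy have
the right derivatives \<open>A(\<phi>) = \<integral> r G\<^sub>z(r, \<xi>) \<phi>(\<alpha>(\<xi>)) d\<kappa>\<close> and \<open>B(\<phi>) = \<integral> \<psi>(u(x), x) \<phi>(x) d\<mu>\<close>.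

If \<open>A(\<phi>) > 0\<close>, then \<open>\<Omega>\<^sub>t\<close> competes with \<open>\<Omega>\<close> for small \<open>t > 0\<close>, and so \<open>B(\<phi>) \<ge> 0\<close>. Two linear functionals
with this relation and \<open>A(1) > 0\<close> are proportional: \<open>B = \<tau> A\<close> with \<open>\<tau> = B(1) / A(1)\<close>. Now \<open>B\<close> is integration
against \<open>\<psi>(u) \<mu>\<close>, and \<open>A\<close> is integration against the image under \<open>\<alpha>\<close> of \<open>r G\<^sub>z(r, \<xi>) \<kappa>\<close>. This image is the
dual curvature measure (\<open>dual_curvature_eq\<close>), and finite Borel measures that integrate continuous
functions alike are equal (\<open>borel_measure_eqI_continuous\<close>).\<close>

section \<open>Linear functionals on a compact set\<close>

definition maximizers :: "'a::euclidean_space set \<Rightarrow> 'a \<Rightarrow> 'a set" where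
  "maximizers T x = {q \<in> T. \<forall>p\<in>T. x \<bullet> p \<le> x \<bullet> q}"

lemma maximizers_scaleR:
  assumes "c > 0"
  shows "maximizers T (c *\<^sub>R x) = maximizers T x"
  using assms by (simp add: maximizers_def)

lemma closed_has_maximizer_in:
  fixes T C :: "'a::euclidean_space set"
  assumes T: "compact T" and C: "closed C"
  shows "closed {x. maximizers T x \<inter> C \<noteq> {}}"
proof -
  have "closed {z :: 'a \<times> 'a. \<forall>p\<in>T. snd z \<bullet> p \<le> snd z \<bullet> fst z}"
  proof -
    have "{z :: 'a \<times> 'a. \<forall>p\<in>T. snd z \<bullet> p \<le> snd z \<bullet> fst z} = (\<Inter>p\<in>T. {z. snd z \<bullet> p \<le> snd z \<bullet> fst z})"
      by auto
    also have "closed \<dots>"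
      by (intro closed_INT ballI closed_Collect_le continuous_intros)
    finally show ?thesis .
  qed
  moreover have "compact (T \<inter> C)"
    using assms by (rule compact_Int_closed)
  ultimately have "closed {x. \<exists>q. q \<in> T \<inter> C \<and> (q, x) \<in> {z. \<forall>p\<in>T. snd z \<bullet> p \<le> snd z \<bullet> fst z}}"
    by (rule closed_compact_projection[rotated])
  also have "{x. \<exists>q. q \<in> T \<inter> C \<and> (q, x) \<in> {z. \<forall>p\<in>T. snd z \<bullet> p \<le> snd z \<bullet> fst z}}
      = {x. maximizers T x \<inter> C \<noteq> {}}"
    by (auto simp: maximizers_def)
  finally show ?thesis .
qed

text \<open>A linear functional that is tilted towards \<open>b\<close> moves its maximizers in the direction of \<open>b\<close>: add the two
maximality conditions.\<close>

lemma maximizers_monotone: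
  assumes q: "q \<in> maximizers T (x + s *\<^sub>R b)" and q': "q' \<in> maximizers T (x + t *\<^sub>R b)"
    and "s < t"
  shows "b \<bullet> q \<le> b \<bullet> q'"
proof -
  have "(x + s *\<^sub>R b) \<bullet> q' \<le> (x + s *\<^sub>R b) \<bullet> q" "(x + t *\<^sub>R b) \<bullet> q \<le> (x + t *\<^sub>R b) \<bullet> q'"
    using q q' by (auto simp: maximizers_def)
  then have "(t - s) * (b \<bullet> q) \<le> (t - s) * (b \<bullet> q')"
    by (simp add: inner_add_left algebra_simps)
  then show ?thesis
    using \<open>s < t\<close> by simp
qed

text \<open>Rays from \<open>b\<close> meet this closed set at most once, which makes it a null set by \<open>starlike_negligible\<close>. Indeed
\<open>b + c x\<close> has the same maximizers as \<open>x + b / c\<close>, so that moving along the ray amounts to moving along a line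
in the direction \<open>b\<close>. Each point of the set has maximizers on both sides of the slab between \<open>k\<close> and \<open>l\<close>,
and two such points on one line would contradict \<open>maximizers_monotone\<close>.\<close>

lemma negligible_maximizers_separated:
  fixes T :: "'a::euclidean_space set"
  assumes T: "compact T" and "k < l"
  shows "negligible {x. maximizers T x \<inter> {q. b \<bullet> q \<le> k} \<noteq> {} \<and> maximizers T x \<inter> {q. l \<le> b \<bullet> q} \<noteq> {}}"
    (is "negligible ?S")
proof (rule starlike_negligible)
  have "?S = {x. maximizers T x \<inter> {q. b \<bullet> q \<le> k} \<noteq> {}} \<inter> {x. maximizers T x \<inter> {q. l \<le> b \<bullet> q} \<noteq> {}}"
    by auto
  also have "closed \<dots>"
    by (intro closed_Int closed_has_maximizer_in T closed_Collect_le continuous_intros)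
  finally show "closed ?S" .
next
  fix c x
  assume 1: "b + c *\<^sub>R x \<in> ?S" and c: "0 \<le> c" and 2: "b + x \<in> ?S"
  \<comment> \<open>\<open>b\<close> itself is not in the set: all maximizers of \<open>b \<bullet> q\<close> have the same value of \<open>b \<bullet> q\<close>.\<close>
  have "c \<noteq> 0"
  proof
    assume "c = 0"
    with 1 obtain q1 q2 where "q1 \<in> maximizers T b" "q2 \<in> maximizers T b" "b \<bullet> q1 \<le> k" "l \<le> b \<bullet> q2"
      by auto
    moreover from this have "b \<bullet> q1 = b \<bullet> q2"
      by (simp add: maximizers_def order_antisym)
    ultimately show False
      using \<open>k < l\<close> by simp
  qed
  with c have c: "c > 0" by simp
  have "maximizers T (b + c *\<^sub>R x) = maximizers T (x + (1 / c) *\<^sub>R b)"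
    using c maximizers_scaleR[of "1/c" T "b + c *\<^sub>R x"] by (simp add: scaleR_add_right add.commute)
  with 1 obtain q1 q2 where q: "q1 \<in> maximizers T (x + (1 / c) *\<^sub>R b)"
      "q2 \<in> maximizers T (x + (1 / c) *\<^sub>R b)" "b \<bullet> q1 \<le> k" "l \<le> b \<bullet> q2"
    by auto
  from 2 obtain q3 q4 where q': "q3 \<in> maximizers T (x + 1 *\<^sub>R b)"
      "q4 \<in> maximizers T (x + 1 *\<^sub>R b)" "b \<bullet> q3 \<le> k" "l \<le> b \<bullet> q4"
    by (auto simp: add.commute)
  have "\<not> 1 / c < 1" "\<not> 1 < 1 / c"
    using maximizers_monotone[OF q(2) q'(1)] maximizers_monotone[OF q'(2) q(1)] q q' \<open>k < l\<close> by auto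
  then have "1 / c = 1" by linarith
  then show "c = 1" using c by simp
qed

text \<open>This says that the support function of a compact set, being convex, is differentiable almost everywhere: its
subgradients at \<open>x\<close> are convex combinations of the maximizers. Two distinct maximizers are separated in some
coordinate by a slab with rational ends, and there are countably many such slabs.\<close>

lemma nonunique_maximizer_null:
  fixes T :: "'a::euclidean_space set"
  assumes T: "compact T"
  shows "{x. \<exists>q\<in>maximizers T x. \<exists>q'\<in>maximizers T x. q \<noteq> q'} \<in> null_sets lborel" (is "?B \<in> _")
proof -
  let ?S = "\<lambda>(b, k, l). {x. maximizers T x \<inter> {q. b \<bullet> q \<le> k} \<noteq> {}} \<inter> {x. maximizers T x \<inter> {q. l \<le> b \<bullet> q} \<noteq> {}}"
  let ?I = "{(b, k, l) \<in> (Basis :: 'a set) \<times> \<rat> \<times> \<rat>. k < (l::real)}"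
  have "?B = (\<Union>i\<in>?I. ?S i)"
  proof (intro equalityI subsetI)
    fix x assume "x \<in> ?B"
    then have "\<exists>q\<in>maximizers T x. \<exists>q'\<in>maximizers T x. \<exists>b\<in>Basis. b \<bullet> q < b \<bullet> q'"
      by clarsimp (metis euclidean_eqI inner_commute linorder_neqE)
    then obtain q q' b where **: "q \<in> maximizers T x" "q' \<in> maximizers T x" "b \<in> Basis" "b \<bullet> q < b \<bullet> q'"
      by auto
    obtain k where k: "k \<in> \<rat>" "b \<bullet> q < k" "k < b \<bullet> q'"
      using Rats_dense_in_real[OF **(4)] by auto
    obtain l where l: "l \<in> \<rat>" "k < l" "l < b \<bullet> q'"
      using Rats_dense_in_real[OF k(3)] by auto
    have "x \<in> ?S (b, k, l)"
      using ** k l by (auto intro!: exI[of _ q] exI[of _ q'])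
    moreover have "(b, k, l) \<in> ?I"
      using ** k l by simp
    ultimately show "x \<in> (\<Union>i\<in>?I. ?S i)"
      by blast
  next
    fix x assume "x \<in> (\<Union>i\<in>?I. ?S i)"
    then obtain b k l where kl: "k < l" "x \<in> ?S (b, k, l)"
      by auto
    then obtain q q' where "q \<in> maximizers T x" "q' \<in> maximizers T x" "b \<bullet> q \<le> k" "l \<le> b \<bullet> q'"
      by auto
    moreover from this kl(1) have "q \<noteq> q'" by auto
    ultimately show "x \<in> ?B" by blast
  qed
  also have "\<dots> \<in> null_sets lborel"
  proof (rule null_sets_UN')
    have "countable ((Basis :: 'a set) \<times> (\<rat> :: real set) \<times> (\<rat> :: real set))"
      by (intro countable_SIGMA countable_rat) (simp add: countable_finite)
    then show "countable ?I"
      by (rule countable_subset[rotated]) auto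
  next
    fix i assume "i \<in> ?I"
    then obtain b k l where i: "i = (b, k, l)" "k < l" by auto
    have "closed (?S i)"
      unfolding i prod.case
      by (intro closed_Int closed_has_maximizer_in T closed_Collect_le continuous_intros)
    moreover have "negligible (?S i)"
      unfolding i prod.case using negligible_maximizers_separated[OF T i(2), of b]
      by (simp add: Collect_conj_eq)
    ultimately show "?S i \<in> null_sets lborel"
      by (simp add: negligible_iff_null_sets null_sets_completion_iff)
  qed
  finally show ?thesis .
qed

lemma space_spherical_measure: "space (spherical_measure :: 'a::euclidean_space measure) = sphere 0 1"
  and sets_spherical_measure: "sets (spherical_measure :: 'a::euclidean_space measure) = sets sphere_borel"
  by (simp_all add: spherical_measure_def space_scale_measure space_restrict_space)

text \<open>The spherical measure of a set is proportional to the volume of the cone over it, truncated by the unit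
ball. This cone lies in \<open>B\<close> if \<open>B\<close> contains the rays through its unit vectors.\<close>

lemma AE_spherical_measure_cone:
  fixes B :: "'a::euclidean_space set"
  assumes B: "B \<in> null_sets lborel" and cone: "\<And>x. x \<noteq> 0 \<Longrightarrow> sgn x \<in> B \<Longrightarrow> x \<in> B"
  shows "AE \<xi> in spherical_measure. \<xi> \<notin> B"
proof (rule AE_I')
  have E: "B \<inter> sphere 0 1 \<in> sets (sphere_borel :: 'a measure)"
    using B by (auto simp: sets_restrict_space null_sets_def)
  have "{x \<in> cball (0::'a) 1 - {0}. sgn x \<in> B \<inter> sphere 0 1} \<subseteq> B"
    using cone by auto
  then have "emeasure lborel {x \<in> cball (0::'a) 1 - {0}. sgn x \<in> B \<inter> sphere 0 1} = 0"
    using B by (metis emeasure_mono le_zero_eq null_setsD1 null_setsD2)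
  then show "B \<inter> sphere 0 1 \<in> null_sets spherical_measure"
    using E by (simp add: null_sets_def sets_spherical_measure emeasure_spherical_measure)
  show "{x \<in> space spherical_measure. \<not> x \<notin> B} \<subseteq> B \<inter> sphere 0 1"
    by (auto simp: space_spherical_measure)
qed

lemma AE_unique_maximizer:
  fixes T :: "'a::euclidean_space set"
  assumes T: "compact T"
  shows "AE \<xi> in spherical_measure. \<forall>q\<in>maximizers T \<xi>. \<forall>q'\<in>maximizers T \<xi>. q = q'"
proof -
  have "maximizers T (sgn x) = maximizers T x" if "x \<noteq> 0" for x
    using that by (simp add: sgn_div_norm maximizers_scaleR)
  then have "AE \<xi> in spherical_measure. \<xi> \<notin> {x. \<exists>q\<in>maximizers T x. \<exists>q'\<in>maximizers T x. q \<noteq> q'}"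
    by (intro AE_spherical_measure_cone nonunique_maximizer_null T) auto
  then show ?thesis by eventually_elim auto
qed

lemma AE_spherical_measure_hyperplane:
  fixes a :: "'a::euclidean_space"
  assumes "a \<noteq> 0"
  shows "AE \<xi> in spherical_measure. a \<bullet> \<xi> \<noteq> 0"
proof -
  have "closed {x. a \<bullet> x = 0}"
    by (rule closed_hyperplane)
  then have "{x. a \<bullet> x = 0} \<in> null_sets lborel"
    using negligible_hyperplane[of a 0] assms
    by (simp add: negligible_iff_null_sets null_sets_completion_iff)
  then have "AE \<xi> in spherical_measure. \<xi> \<notin> {x. a \<bullet> x = 0}"
    by (rule AE_spherical_measure_cone) (simp add: sgn_div_norm)
  then show ?thesis by simp
qed

section \<open>Radial functions, support functions and Wulff shapes\<close>

lemma compact_in_cball: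
  assumes "compact (K :: 'a::euclidean_space set)"
  obtains R where "R > 0" "K \<subseteq> cball 0 R"
  using bounded_subset_ballD[OF compact_imp_bounded[OF assms], of 0] ball_subset_cball by blast

lemma radial_function_compact:
  fixes K :: "'a::euclidean_space set"
  assumes "compact K" "0 \<in> K" and x: "x \<in> sphere 0 1"
  shows radial_in: "radial_function K x *\<^sub>R x \<in> K"
    and radial_upper: "a *\<^sub>R x \<in> K \<Longrightarrow> a \<le> radial_function K x"
    and radial_nonneg: "0 \<le> radial_function K x"
proof -
  let ?A = "{a. a *\<^sub>R x \<in> K}"
  obtain B where B: "\<And>y. y \<in> K \<Longrightarrow> norm y \<le> B"
    using compact_imp_bounded[OF \<open>compact K\<close>] unfolding bounded_iff by blast
  have bdd: "bdd_above ?A"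
    using B x by (intro bdd_aboveI[of _ B]) fastforce
  have "?A = (\<lambda>a. a *\<^sub>R x) -` K"
    by auto
  moreover have "closed ((\<lambda>a. a *\<^sub>R x) -` K)"
    using assms by (intro continuous_closed_vimage compact_imp_closed) simp_all
  ultimately have "closed ?A" by simp
  moreover have "0 \<in> ?A"
    using \<open>0 \<in> K\<close> by simp
  ultimately have "Sup ?A \<in> ?A"
    using bdd by (intro closed_contains_Sup) blast+
  then show "radial_function K x *\<^sub>R x \<in> K"
    by (simp add: radial_function_def)
  show upper: "a *\<^sub>R x \<in> K \<Longrightarrow> a \<le> radial_function K x" for a
    unfolding radial_function_def by (rule cSup_upper[OF _ bdd]) simp
  show "0 \<le> radial_function K x"
    using upper[of 0] \<open>0 \<in> K\<close> by simp
qed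

lemma scaled_mem_iff_le_radial:
  fixes K :: "'a::euclidean_space set"
  assumes "compact K" "convex K" "0 \<in> K" and x: "x \<in> sphere 0 1" and a: "0 \<le> a"
  shows "a *\<^sub>R x \<in> K \<longleftrightarrow> a \<le> radial_function K x"
proof
  assume le: "a \<le> radial_function K x"
  let ?r = "radial_function K x"
  show "a *\<^sub>R x \<in> K"
  proof (cases "?r = 0")
    case False
    then have "?r > 0" using a le by linarith
    then have "(a / ?r) *\<^sub>R (?r *\<^sub>R x) + (1 - a / ?r) *\<^sub>R 0 \<in> K"
      using assms le by (intro convexD radial_in) auto
    then show ?thesis using \<open>?r > 0\<close> by simp
  qed (use assms le in simp)
qed (use assms radial_upper in blast)

lemma radial_le:
  fixes K :: "'a::euclidean_space set"
  assumes "compact K" "0 \<in> K" "K \<subseteq> cball 0 R" and \<xi>: "\<xi> \<in> sphere 0 1"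
  shows "radial_function K \<xi> \<le> R"
proof -
  have "norm (radial_function K \<xi> *\<^sub>R \<xi>) \<le> R"
    using radial_in[OF assms(1,2) \<xi>] assms(3) by auto
  then show ?thesis using \<xi> by simp
qed

lemma support_function_compact:
  fixes K :: "'a::euclidean_space set"
  assumes "compact K" "0 \<in> K"
  shows support_upper: "y \<in> K \<Longrightarrow> x \<bullet> y \<le> support_function K x"
    and support_nonneg: "0 \<le> support_function K x"
proof -
  have "compact ((\<lambda>y. x \<bullet> y) ` K)"
    by (rule compact_continuous_image[OF _ \<open>compact K\<close>]) (intro continuous_intros)
  then have bdd: "bdd_above ((\<lambda>y. x \<bullet> y) ` K)"
    by (intro bounded_imp_bdd_above compact_imp_bounded)
  show upper: "y \<in> K \<Longrightarrow> x \<bullet> y \<le> support_function K x" for y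
    unfolding support_function_def by (rule cSUP_upper[OF _ bdd])
  show "0 \<le> support_function K x"
    using upper[of 0] assms by simp
qed

lemma support_least:
  assumes "K \<noteq> {}" "\<And>y. y \<in> K \<Longrightarrow> x \<bullet> y \<le> c"
  shows "support_function K x \<le> c"
  unfolding support_function_def using assms by (rule cSUP_least)

lemma support_le:
  fixes K :: "'a::euclidean_space set"
  assumes "0 \<in> K" "K \<subseteq> cball 0 R" and x: "x \<in> sphere 0 1"
  shows "support_function K x \<le> R"
proof (rule support_least)
  fix y assume "y \<in> K"
  then have "norm x * norm y \<le> R" using assms by auto
  then show "x \<bullet> y \<le> R" using norm_cauchy_schwarz[of x y] by simp
qed (use assms in auto)

lemma support_lipschitz:
  fixes K :: "'a::euclidean_space set"
  assumes "compact K" "0 \<in> K" "K \<subseteq> cball 0 R"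
  shows "\<bar>support_function K x - support_function K x'\<bar> \<le> R * norm (x - x')"
proof -
  have *: "support_function K x \<le> support_function K x' + R * norm (x - x')" for x x'
  proof (rule support_least)
    fix y assume y: "y \<in> K"
    have "x \<bullet> y = x' \<bullet> y + (x - x') \<bullet> y"
      by (simp add: inner_diff_left)
    also have "(x - x') \<bullet> y \<le> norm (x - x') * norm y"
      by (rule norm_cauchy_schwarz)
    also have "\<dots> \<le> R * norm (x - x')"
      using y assms by (auto simp: mult.commute[of R] intro!: mult_left_mono)
    also have "x' \<bullet> y \<le> support_function K x'"
      by (rule support_upper) (use assms y in auto)
    finally show "x \<bullet> y \<le> support_function K x' + R * norm (x - x')" by simp
  qed (use assms in auto)
  show ?thesis
    using *[of x x'] *[of x' x] by (simp add: norm_minus_commute abs_le_iff)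
qed

lemma continuous_on_support:
  fixes K :: "'a::euclidean_space set"
  assumes "compact K" "0 \<in> K"
  shows "continuous_on S (support_function K)"
proof -
  obtain R where R: "R > 0" "K \<subseteq> cball 0 R"
    using compact_in_cball[OF assms(1)] .
  have "R-lipschitz_on S (support_function K)"
    using support_lipschitz[OF assms R(2)] R(1)
    by (intro lipschitz_onI) (auto simp: dist_norm)
  then show ?thesis
    by (rule lipschitz_on_continuous_on)
qed

definition wulff :: "('a::euclidean_space \<Rightarrow> real) \<Rightarrow> 'a set" where
  "wulff h = {y. \<forall>x\<in>sphere 0 1. x \<bullet> y \<le> h x}"

lemma convex_wulff: "convex (wulff h)"
proof -
  have "wulff h = (\<Inter>x\<in>sphere 0 1. {y. x \<bullet> y \<le> h x})"
    by (auto simp: wulff_def)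
  then show ?thesis
    by (auto intro!: convex_INT convex_halfspace_le)
qed

lemma wulff_bound:
  assumes "\<forall>x\<in>sphere 0 1. h x \<le> R" "y \<in> wulff h" "0 \<le> R"
  shows "norm y \<le> R"
proof (cases "y = 0")
  case False
  then have "sgn y \<in> sphere 0 1" by (simp add: norm_sgn)
  then have "sgn y \<bullet> y \<le> R"
    using assms by (force simp: wulff_def)
  moreover have "sgn y \<bullet> y = norm y"
    using False by (simp add: sgn_div_norm dot_square_norm power2_eq_square)
  ultimately show ?thesis by simp
qed (use assms in simp)

lemma compact_wulff:
  fixes h :: "'a::euclidean_space \<Rightarrow> real"
  assumes "\<forall>x\<in>sphere 0 1. h x \<le> R" "0 \<le> R"
  shows "compact (wulff h)"
proof -
  have "wulff h = (\<Inter>x\<in>sphere 0 1. {y. x \<bullet> y \<le> h x})"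
    by (auto simp: wulff_def)
  then have "closed (wulff h)"
    by (auto intro!: closed_INT closed_halfspace_le)
  moreover have "bounded (wulff h)"
    using wulff_bound[OF assms(1) _ assms(2)] by (auto simp: bounded_iff)
  ultimately show ?thesis
    by (simp add: compact_eq_bounded_closed)
qed

lemma zero_in_wulff:
  assumes "\<forall>x\<in>sphere 0 1. 0 \<le> h x"
  shows "0 \<in> wulff h"
  using assms by (simp add: wulff_def)

lemma support_wulff_le:
  assumes "\<forall>x\<in>sphere 0 1. 0 \<le> h x" "x \<in> sphere 0 1"
  shows "support_function (wulff h) x \<le> h x"
proof (rule support_least)
  show "wulff h \<noteq> {}"
    using zero_in_wulff[OF assms(1)] by blast
qed (use assms(2) in \<open>auto simp: wulff_def\<close>)

text \<open>A closed convex set is the intersection of its supporting half-spaces.\<close>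

lemma wulff_support:
  fixes K :: "'a::euclidean_space set"
  assumes "compact K" "convex K" "0 \<in> K"
  shows "wulff (support_function K) = K"
proof (intro equalityI subsetI)
  fix y assume "y \<in> K"
  then show "y \<in> wulff (support_function K)"
    using assms by (auto simp: wulff_def support_upper)
next
  fix y assume y: "y \<in> wulff (support_function K)"
  show "y \<in> K"
  proof (rule ccontr)
    assume "y \<notin> K"
    then obtain a b where ab: "a \<bullet> y < b" "\<And>x. x \<in> K \<Longrightarrow> b < a \<bullet> x"
      using separating_hyperplane_closed_point[of K y] assms compact_imp_closed by blast
    have "b < 0" using ab(2)[of 0] assms by simp
    then have "a \<noteq> 0" using ab by auto
    then have "sgn (- a) \<in> sphere 0 1" by (simp add: norm_sgn)
    then have "sgn (- a) \<bullet> y \<le> support_function K (sgn (- a))"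
      using y by (simp add: wulff_def)
    also have "\<dots> \<le> - b / norm a"
    proof (rule support_least)
      fix x assume "x \<in> K"
      then have "- (a \<bullet> x) / norm a \<le> - b / norm a"
        using ab(2)[of x] by (intro divide_right_mono) auto
      then show "sgn (- a) \<bullet> x \<le> - b / norm a"
        by (simp add: sgn_div_norm divide_inverse mult.commute)
    qed (use assms in auto)
    finally have "- (a \<bullet> y) / norm a \<le> - b / norm a"
      by (simp add: sgn_div_norm divide_inverse mult.commute)
    then show False using ab(1) \<open>a \<noteq> 0\<close> by (simp add: divide_le_cancel)
  qed
qed

section \<open>Unit normals in almost every direction\<close>

text \<open>The outer unit normals of \<open>K\<close> at its boundary point in the direction \<open>\<xi>\<close>.\<close>

definition normals :: "'a::euclidean_space set \<Rightarrow> 'a \<Rightarrow> 'a set" where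
  "normals K \<xi> = {x \<in> sphere 0 1. x \<bullet> (radial_function K \<xi> *\<^sub>R \<xi>) = support_function K x}"

text \<open>Without a normal in the direction \<open>\<xi>\<close>, compactness of the sphere leaves a gap \<open>d > 0\<close> in all the inequalities
\<open>x \<bullet> r \<xi> \<le> u x\<close>, and \<open>(r + d) \<xi>\<close> still satisfies them.\<close>

lemma normals_nonempty:
  fixes K :: "'a::euclidean_space set"
  assumes K: "compact K" "convex K" "0 \<in> K" and \<xi>: "\<xi> \<in> sphere 0 1"
  shows "normals K \<xi> \<noteq> {}"
proof
  let ?r = "radial_function K \<xi>"
  assume empty: "normals K \<xi> = {}"
  have "continuous_on (sphere 0 1) (\<lambda>x. support_function K x - x \<bullet> (?r *\<^sub>R \<xi>))"
    using K by (intro continuous_intros continuous_on_support)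
  moreover have "sphere (0::'a) 1 \<noteq> {}"
    using \<xi> by blast
  ultimately obtain x0 where x0: "x0 \<in> sphere 0 1" and
    min: "\<And>x. x \<in> sphere 0 1 \<Longrightarrow> support_function K x0 - x0 \<bullet> (?r *\<^sub>R \<xi>) \<le> support_function K x - x \<bullet> (?r *\<^sub>R \<xi>)"
    using continuous_attains_inf[OF compact_sphere] by blast
  define d where "d = support_function K x0 - x0 \<bullet> (?r *\<^sub>R \<xi>)"
  have "d > 0"
    using empty x0 support_upper[OF K(1,3) radial_in[OF K(1,3) \<xi>], of x0]
    by (force simp: normals_def d_def)
  have "(?r + d) *\<^sub>R \<xi> \<in> wulff (support_function K)"
    unfolding wulff_def
  proof safe
    fix x :: 'a assume x: "x \<in> sphere 0 1"
    have "x \<bullet> \<xi> \<le> 1"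
      using norm_cauchy_schwarz[of x \<xi>] x \<xi> by simp
    then have "d * (x \<bullet> \<xi>) \<le> d"
      using \<open>d > 0\<close> by simp
    then show "x \<bullet> ((?r + d) *\<^sub>R \<xi>) \<le> support_function K x"
      using min[OF x] by (simp add: d_def algebra_simps)
  qed
  then have "(?r + d) *\<^sub>R \<xi> \<in> K"
    using wulff_support[OF K] by simp
  then have "?r + d \<le> ?r"
    by (rule radial_upper[OF K(1,3) \<xi>])
  then show False using \<open>d > 0\<close> by simp
qed

text \<open>If \<open>x\<close> is a normal at \<open>r \<xi>\<close> and \<open>u x > 0\<close>, then \<open>x / u x\<close> maximizes \<open>\<xi> \<bullet> q\<close> over all \<open>q = y / u y\<close> with \<open>y\<close> in
the sphere and \<open>u y > 0\<close>; the value is \<open>1 / r\<close>. The sets \<open>?T m\<close> below exhaust these \<open>q\<close> by compact sets, so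
unique maximizers give unique normals. If \<open>u x = 0\<close> instead, then \<open>x\<close> and \<open>0\<close> are two maximizers of
\<open>\<xi> \<bullet> q\<close> over the normal cone at the origin, cut off by the unit ball. This happens only for \<open>\<xi>\<close> in a null
set.\<close>

lemma AE_unique_normal:
  fixes K :: "'a::euclidean_space set"
  assumes K: "compact K" "convex K" "0 \<in> K"
  shows "AE \<xi> in spherical_measure. radial_function K \<xi> > 0 \<longrightarrow>
    (\<exists>x. normals K \<xi> = {x} \<and> support_function K x > 0)"
proof -
  let ?u = "support_function K"
  let ?C = "\<lambda>m::nat. {x \<in> sphere 0 1. 1 / Suc m \<le> ?u x}"
  let ?T = "\<lambda>m. (\<lambda>x. (1 / ?u x) *\<^sub>R x) ` ?C m"
  let ?N = "{y \<in> cball 0 1. \<forall>z\<in>K. z \<bullet> y \<le> 0}"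
  have T: "compact (?T m)" for m
  proof (rule compact_continuous_image)
    have ne: "?u x \<noteq> 0" if "x \<in> ?C m" for x
    proof -
      have "0 < 1 / real (Suc m)" by simp
      also have "\<dots> \<le> ?u x" using that by simp
      finally show ?thesis by simp
    qed
    then show "continuous_on (?C m) (\<lambda>x. (1 / ?u x) *\<^sub>R x)"
      by (intro continuous_intros continuous_on_support K) auto
    have "?C m = sphere 0 1 \<inter> {x. 1 / Suc m \<le> ?u x}" by auto
    moreover have "closed {x. 1 / Suc m \<le> ?u x}"
      by (intro closed_Collect_le continuous_intros continuous_on_support K)
    ultimately show "compact (?C m)"
      by (simp add: compact_Int_closed)
  qed
  have N: "compact ?N"
  proof -
    have "?N = cball 0 1 \<inter> (\<Inter>z\<in>K. {y. z \<bullet> y \<le> 0})" by auto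
    moreover have "closed (\<Inter>z\<in>K. {y. z \<bullet> y \<le> 0})"
      by (intro closed_INT ballI closed_halfspace_le)
    ultimately show ?thesis
      by (simp add: compact_Int_closed)
  qed
  have "AE \<xi> in spherical_measure. \<forall>m. \<forall>q\<in>maximizers (?T m) \<xi>. \<forall>q'\<in>maximizers (?T m) \<xi>. q = q'"
    unfolding AE_all_countable using AE_unique_maximizer[OF T] by blast
  moreover have "AE \<xi> in spherical_measure. \<forall>q\<in>maximizers ?N \<xi>. \<forall>q'\<in>maximizers ?N \<xi>. q = q'"
    by (rule AE_unique_maximizer[OF N])
  moreover have "AE \<xi> in spherical_measure. \<xi> \<in> (sphere 0 1 :: 'a set)"
    using AE_space[of "spherical_measure :: 'a measure"] by (simp add: space_spherical_measure)
  ultimately show ?thesis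
  proof eventually_elim
    case (elim \<xi>)
    note uniqT = elim(1)[rule_format] and uniqN = elim(2)[rule_format] and \<xi> = elim(3)
    let ?r = "radial_function K \<xi>"
    show ?case
    proof
      assume r: "?r > 0"
      have r_in: "?r *\<^sub>R \<xi> \<in> K" by (rule radial_in[OF K(1,3) \<xi>])
      have pos: "?u x > 0" if x: "x \<in> normals K \<xi>" for x
      proof (rule ccontr)
        assume "\<not> ?u x > 0"
        then have u0: "?u x = 0" using support_nonneg[OF K(1,3), of x] by simp
        have le: "\<xi> \<bullet> p \<le> 0" if "p \<in> ?N" for p
        proof -
          have "(?r *\<^sub>R \<xi>) \<bullet> p \<le> 0" using that r_in by blast
          then show ?thesis using r by (simp add: mult_le_0_iff)
        qed
        have x_xi: "\<xi> \<bullet> x = 0"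
          using x u0 r by (simp add: normals_def inner_commute)
        have "z \<bullet> x \<le> 0" if "z \<in> K" for z
          using support_upper[OF K(1,3) that, of x] u0 by (simp add: inner_commute)
        then have "x \<in> ?N" using x by (simp add: normals_def)
        then have "x \<in> maximizers ?N \<xi>" "0 \<in> maximizers ?N \<xi>"
          using le x_xi by (simp_all add: maximizers_def)
        then have "x = 0" by (rule uniqN)
        then show False using x by (simp add: normals_def)
      qed
      have max: "(1 / ?u x) *\<^sub>R x \<in> maximizers (?T m) \<xi>"
        if x: "x \<in> normals K \<xi>" and m: "1 / Suc m \<le> ?u x" for x m
      proof -
        have "\<xi> \<bullet> ((1 / ?u x) *\<^sub>R x) = 1 / ?r"
          using x pos[OF x] r by (simp add: normals_def inner_commute field_simps)
        moreover have "\<xi> \<bullet> ((1 / ?u y) *\<^sub>R y) \<le> 1 / ?r" if "y \<in> ?C m" for y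
        proof -
          have "0 < 1 / real (Suc m)" by simp
          also have "\<dots> \<le> ?u y" using that by simp
          finally have "?u y > 0" .
          moreover have "?r * (\<xi> \<bullet> y) \<le> ?u y"
            using support_upper[OF K(1,3) r_in, of y] by (simp add: inner_commute)
          ultimately show ?thesis using r by (simp add: field_simps)
        qed
        ultimately show ?thesis
          using x m by (auto simp: maximizers_def normals_def)
      qed
      have uniq: "x = y" if x: "x \<in> normals K \<xi>" and y: "y \<in> normals K \<xi>" for x y
      proof -
        have "min (?u x) (?u y) > 0" using pos x y by simp
        then obtain m where m: "1 / Suc m < min (?u x) (?u y)"
          using nat_approx_posE by blast
        have eq: "(1 / ?u x) *\<^sub>R x = (1 / ?u y) *\<^sub>R y"
          by (rule uniqT[of _ m]; rule max) (use x y m in auto)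
        then have "norm ((1 / ?u x) *\<^sub>R x) = norm ((1 / ?u y) *\<^sub>R y)" by simp
        then have "?u x = ?u y"
          using x y pos[OF x] pos[OF y] by (simp add: normals_def)
        then show "x = y" using eq pos[OF x] by simp
      qed
      obtain x where x: "x \<in> normals K \<xi>" using normals_nonempty[OF K \<xi>] by blast
      then have "normals K \<xi> = {x}" using uniq by blast
      then show "\<exists>x. normals K \<xi> = {x} \<and> ?u x > 0" using pos[OF x] by blast
    qed
  qed
qed

section \<open>Multiplicative perturbations of a body\<close>

definition perturbed :: "'a::euclidean_space set \<Rightarrow> ('a \<Rightarrow> real) \<Rightarrow> real \<Rightarrow> 'a set" where
  "perturbed K \<phi> t = wulff (\<lambda>x. support_function K x * exp (t * \<phi> x))"

lemma perturbed_body: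
  fixes K :: "'a::euclidean_space set"
  assumes K: "compact K" "convex K" "0 \<in> K"
    and \<phi>: "\<forall>x\<in>sphere 0 1. \<bar>\<phi> x\<bar> \<le> M" and t: "0 \<le> t" and M: "0 \<le> M"
  shows compact_perturbed: "compact (perturbed K \<phi> t)"
    and convex_perturbed: "convex (perturbed K \<phi> t)"
    and zero_in_perturbed: "0 \<in> perturbed K \<phi> t"
    and support_perturbed_le: "x \<in> sphere 0 1 \<Longrightarrow>
      support_function (perturbed K \<phi> t) x \<le> support_function K x * exp (t * \<phi> x)"
proof -
  obtain R where R: "R > 0" "K \<subseteq> cball 0 R"
    using compact_in_cball[OF K(1)] .
  have uR: "support_function K x \<le> R" if "x \<in> sphere 0 1" for x
    by (rule support_le[OF K(3) R(2) that])
  show "compact (perturbed K \<phi> t)"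
    unfolding perturbed_def
  proof (rule compact_wulff, intro ballI)
    fix x :: 'a assume x: "x \<in> sphere 0 1"
    have "t * \<phi> x \<le> t * M" using bspec[OF \<phi> x] t by (intro mult_left_mono) auto
    then show "support_function K x * exp (t * \<phi> x) \<le> R * exp (t * M)"
      using uR[OF x] R(1) support_nonneg[OF K(1,3), of x] by (intro mult_mono) auto
  qed (use R in simp)
  show "convex (perturbed K \<phi> t)"
    unfolding perturbed_def by (rule convex_wulff)
  have nn: "0 \<le> support_function K x * exp (t * \<phi> x)" for x
    using support_nonneg[OF K(1,3), of x] by simp
  show "0 \<in> perturbed K \<phi> t"
    unfolding perturbed_def using nn by (intro zero_in_wulff ballI)
  show "x \<in> sphere 0 1 \<Longrightarrow>
      support_function (perturbed K \<phi> t) x \<le> support_function K x * exp (t * \<phi> x)"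
    unfolding perturbed_def using nn by (intro support_wulff_le ballI)
qed

text \<open>The difference quotient of the logarithm of the radial function. It is \<open>0\<close> when the radial function of \<open>K\<close>
vanishes in the direction \<open>\<xi>\<close>, because division by zero and \<open>ln 0\<close> give \<open>0\<close>; this fits
\<open>radial_perturbed_eq\<close>, as the radial function of the perturbed body vanishes there too.\<close>

definition log_rate :: "'a::euclidean_space set \<Rightarrow> ('a \<Rightarrow> real) \<Rightarrow> real \<Rightarrow> 'a \<Rightarrow> real" where
  "log_rate K \<phi> t \<xi> = ln (radial_function (perturbed K \<phi> t) \<xi> / radial_function K \<xi>) / t"

lemma radial_perturbed:
  fixes K :: "'a::euclidean_space set"
  assumes K: "compact K" "convex K" "0 \<in> K"
    and \<phi>: "\<forall>x\<in>sphere 0 1. \<bar>\<phi> x\<bar> \<le> M" and t: "0 < t" and M: "0 \<le> M"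
    and \<xi>: "\<xi> \<in> sphere 0 1"
  shows radial_perturbed_eq:
      "radial_function (perturbed K \<phi> t) \<xi> = radial_function K \<xi> * exp (t * log_rate K \<phi> t \<xi>)" (is ?A)
    and log_rate_bound: "\<bar>log_rate K \<phi> t \<xi>\<bar> \<le> M" (is ?B)
proof -
  let ?r = "radial_function K \<xi>" and ?r' = "radial_function (perturbed K \<phi> t) \<xi>"
  note K' = perturbed_body[OF K \<phi> less_imp_le[OF t] M]
  have tM: "- (t * M) \<le> t * \<phi> x" "t * \<phi> x \<le> t * M" if "x \<in> sphere 0 1" for x
    using bspec[OF \<phi> that] t mult_left_mono[of "\<phi> x" M t] mult_left_mono[of "- M" "\<phi> x" t] by auto
  have r0: "0 \<le> ?r" "0 \<le> ?r'"
    using radial_nonneg K K'(1,3) \<xi> by blast+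
  have "(?r * exp (- (t * M))) *\<^sub>R \<xi> \<in> perturbed K \<phi> t"
    unfolding perturbed_def wulff_def
  proof safe
    fix x :: 'a assume x: "x \<in> sphere 0 1"
    have "x \<bullet> ((?r * exp (- (t * M))) *\<^sub>R \<xi>) = (x \<bullet> (?r *\<^sub>R \<xi>)) * exp (- (t * M))"
      by simp
    also have "\<dots> \<le> support_function K x * exp (- (t * M))"
      using support_upper[OF K(1,3) radial_in[OF K(1,3) \<xi>]] by (intro mult_right_mono) auto
    also have "\<dots> \<le> support_function K x * exp (t * \<phi> x)"
      using tM[OF x] support_nonneg[OF K(1,3), of x] by (intro mult_left_mono) auto
    finally show "x \<bullet> ((?r * exp (- (t * M))) *\<^sub>R \<xi>) \<le> support_function K x * exp (t * \<phi> x)" .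
  qed
  then have lower: "?r * exp (- (t * M)) \<le> ?r'"
    by (rule radial_upper[OF K'(1,3) \<xi>])
  have "(?r' * exp (- (t * M))) *\<^sub>R \<xi> \<in> wulff (support_function K)"
    unfolding wulff_def
  proof safe
    fix x :: 'a assume x: "x \<in> sphere 0 1"
    have "x \<bullet> (?r' *\<^sub>R \<xi>) \<le> support_function K x * exp (t * \<phi> x)"
      using radial_in[OF K'(1,3) \<xi>] x unfolding perturbed_def wulff_def by blast
    also have "\<dots> \<le> support_function K x * exp (t * M)"
      using tM[OF x] support_nonneg[OF K(1,3), of x] by (intro mult_left_mono) auto
    finally have "(x \<bullet> (?r' *\<^sub>R \<xi>)) * exp (- (t * M)) \<le> support_function K x * exp (t * M) * exp (- (t * M))"
      by (intro mult_right_mono) auto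
    then show "x \<bullet> ((?r' * exp (- (t * M))) *\<^sub>R \<xi>) \<le> support_function K x"
      by (simp add: exp_minus field_simps)
  qed
  then have "(?r' * exp (- (t * M))) *\<^sub>R \<xi> \<in> K"
    using wulff_support[OF K] by simp
  then have "?r' * exp (- (t * M)) \<le> ?r"
    by (rule radial_upper[OF K(1,3) \<xi>])
  then have upper: "?r' \<le> ?r * exp (t * M)"
    by (simp add: exp_minus field_simps)
  have "?A \<and> ?B"
  proof (cases "?r = 0")
    case True
    then show ?thesis using upper r0 M by (simp add: log_rate_def)
  next
    case False
    then have r: "?r > 0" using r0 by simp
    then have "0 < ?r * exp (- (t * M))" by simp
    also note lower
    finally have r': "?r' > 0" .
    have ?A using r r' t by (simp add: log_rate_def)
    moreover have "exp (- (t * M)) \<le> ?r' / ?r" "?r' / ?r \<le> exp (t * M)"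
      using lower upper r by (simp_all add: field_simps)
    then have "- (t * M) \<le> ln (?r' / ?r)" "ln (?r' / ?r) \<le> t * M"
      using r r' by (simp_all add: ln_ge_iff ln_le_cancel_iff[symmetric, of _ "exp _"] del: ln_le_cancel_iff)
    then have ?B using t by (auto simp: log_rate_def abs_le_iff field_simps)
    ultimately show ?thesis ..
  qed
  then show ?A ?B by auto
qed

text \<open>The normal \<open>x0\<close> itself bounds the radial function of the perturbed body, which gives the upper bound
\<open>\<phi> x0\<close> for every \<open>t\<close>. For the lower bound let \<open>a < \<phi> x0\<close>. The point \<open>r exp (t a) \<xi>\<close> satisfies the inequality
for each \<open>x\<close> with \<open>\<phi> x > a\<close>, since there the bound grows faster than the point; the other \<open>x\<close> form a
compact set without a normal, on which the inequalities hold with a gap for \<open>t = 0\<close>, and therefore still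
hold for small \<open>t\<close>.\<close>

lemma log_rate_tendsto:
  fixes K :: "'a::euclidean_space set"
  assumes K: "compact K" "convex K" "0 \<in> K"
    and cont: "continuous_on (sphere 0 1) \<phi>"
    and \<phi>: "\<forall>x\<in>sphere 0 1. \<bar>\<phi> x\<bar> \<le> M" and M: "0 \<le> M"
    and \<xi>: "\<xi> \<in> sphere 0 1" and r: "radial_function K \<xi> > 0"
    and normal: "normals K \<xi> = {x0}" and u0: "support_function K x0 > 0"
  shows "((\<lambda>t. log_rate K \<phi> t \<xi>) \<longlongrightarrow> \<phi> x0) (at_right 0)"
proof -
  let ?u = "support_function K" and ?r = "radial_function K \<xi>"
  let ?r' = "\<lambda>t. radial_function (perturbed K \<phi> t) \<xi>"
  have x0: "x0 \<in> sphere 0 1" "x0 \<bullet> (?r *\<^sub>R \<xi>) = ?u x0"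
    using normal by (auto simp: normals_def)
  have pos: "?r' t > 0" if "t > 0" for t
    using radial_perturbed_eq[OF K \<phi> that M \<xi>] r by simp
  have upper: "log_rate K \<phi> t \<xi> \<le> \<phi> x0" if t: "t > 0" for t
  proof -
    note K' = perturbed_body[OF K \<phi> less_imp_le[OF t] M]
    have "x0 \<bullet> (?r' t *\<^sub>R \<xi>) \<le> ?u x0 * exp (t * \<phi> x0)"
      using radial_in[OF K'(1,3) \<xi>] x0 unfolding perturbed_def wulff_def by blast
    then have "?r' t * ?u x0 \<le> ?r * exp (t * \<phi> x0) * ?u x0"
      using x0(2)[symmetric] r mult_left_mono[of "?r' t * (x0 \<bullet> \<xi>)" "?u x0 * exp (t * \<phi> x0)" ?r]
      by (simp add: algebra_simps)
    then have "?r' t \<le> ?r * exp (t * \<phi> x0)"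
      using u0 by simp
    then have "?r' t / ?r \<le> exp (t * \<phi> x0)"
      using r by (simp add: field_simps)
    then have "ln (?r' t / ?r) \<le> t * \<phi> x0"
      using r pos[OF t] by (metis divide_pos_pos exp_gt_zero ln_exp ln_le_cancel_iff)
    then show ?thesis
      using t by (simp add: log_rate_def field_simps)
  qed
  show ?thesis
  proof (rule order_tendstoI)
    fix a assume "\<phi> x0 < a"
    then show "\<forall>\<^sub>F t in at_right 0. log_rate K \<phi> t \<xi> < a"
      using upper by (auto simp: eventually_at_right_field intro!: exI[of _ 1] intro: le_less_trans)
  next
    fix a0 assume "a0 < \<phi> x0"
    then obtain a where a: "a0 < a" "a < \<phi> x0" using dense by blast
    let ?C = "{x \<in> sphere 0 1. \<phi> x \<le> a}"
    obtain U where U: "U > 0" "\<And>x. x \<in> sphere 0 1 \<Longrightarrow> ?u x \<le> U"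
      using compact_in_cball[OF K(1)] support_le[OF K(3)] by metis
    obtain d where d: "d > 0" "\<And>x. x \<in> ?C \<Longrightarrow> d \<le> ?u x - x \<bullet> (?r *\<^sub>R \<xi>)"
    proof (cases "?C = {}")
      case True
      show thesis by (rule that[of 1]) (use True in auto)
    next
      case False
      have "closedin (top_of_set (sphere 0 1)) (sphere 0 1 \<inter> \<phi> -` {..a})"
        by (rule continuous_closedin_preimage[OF cont]) simp
      also have "sphere 0 1 \<inter> \<phi> -` {..a} = ?C" by auto
      finally have "compact ?C"
        by (rule closedin_compact[OF compact_sphere])
      moreover have "continuous_on ?C (\<lambda>x. ?u x - x \<bullet> (?r *\<^sub>R \<xi>))"
        by (intro continuous_intros continuous_on_support K)
      ultimately have "\<exists>y\<in>?C. \<forall>x\<in>?C. ?u y - y \<bullet> (?r *\<^sub>R \<xi>) \<le> ?u x - x \<bullet> (?r *\<^sub>R \<xi>)"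
        using False by (intro continuous_attains_inf)
      then obtain y where y: "y \<in> ?C"
        "\<And>x. x \<in> ?C \<Longrightarrow> ?u y - y \<bullet> (?r *\<^sub>R \<xi>) \<le> ?u x - x \<bullet> (?r *\<^sub>R \<xi>)"
        by blast
      have "y \<noteq> x0" using y(1) a by auto
      then have "y \<notin> normals K \<xi>" using normal by simp
      then have "?u y - y \<bullet> (?r *\<^sub>R \<xi>) > 0"
        using y(1) support_upper[OF K(1,3) radial_in[OF K(1,3) \<xi>], of y] by (auto simp: normals_def)
      then show thesis using that y(2) by blast
    qed
    \<comment> \<open>\<open>L\<close> bounds \<open>a - \<phi> x\<close>, so \<open>u x exp (t (\<phi> x - a))\<close> is below \<open>u x\<close> by at most \<open>U t L \<le> d\<close>.\<close>
    define L where "L = M + \<bar>a\<bar> + 1"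
    have L: "L > 0" using M by (simp add: L_def)
    have lower: "a \<le> log_rate K \<phi> t \<xi>" if t: "0 < t" "t < d / (U * L)" for t
    proof -
      note K' = perturbed_body[OF K \<phi> less_imp_le[OF t(1)] M]
      have tUL: "U * (t * L) \<le> d"
        using t(2) U(1) L by (simp add: field_simps)
      have "(?r * exp (t * a)) *\<^sub>R \<xi> \<in> perturbed K \<phi> t"
        unfolding perturbed_def wulff_def
      proof safe
        fix x :: 'a assume x: "x \<in> sphere 0 1"
        have "x \<bullet> (?r *\<^sub>R \<xi>) \<le> ?u x * exp (t * (\<phi> x - a))"
        proof (cases "\<phi> x \<le> a")
          case False
          have "x \<bullet> (?r *\<^sub>R \<xi>) \<le> ?u x * 1"
            using support_upper[OF K(1,3) radial_in[OF K(1,3) \<xi>], of x] by simp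
          also have "\<dots> \<le> ?u x * exp (t * (\<phi> x - a))"
            using False t(1) support_nonneg[OF K(1,3), of x] by (intro mult_left_mono) auto
          finally show ?thesis .
        next
          case True
          have "\<phi> x - a \<ge> - L" using bspec[OF \<phi> x] by (auto simp: L_def)
          then have "- (t * L) \<le> t * (\<phi> x - a)"
            using t(1) mult_left_mono[of "- L" "\<phi> x - a" t] by simp
          then have "1 - exp (t * (\<phi> x - a)) \<le> t * L"
            using exp_ge_add_one_self[of "t * (\<phi> x - a)"] by linarith
          then have "?u x * (1 - exp (t * (\<phi> x - a))) \<le> U * (t * L)"
            using U x support_nonneg[OF K(1,3), of x] t(1) L
            by (meson less_imp_le mult_left_mono mult_mono mult_nonneg_nonneg mult_right_mono order_trans)
          also note tUL
          also have "d \<le> ?u x - x \<bullet> (?r *\<^sub>R \<xi>)" using d(2) x True by simp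
          finally show ?thesis by (simp add: algebra_simps)
        qed
        then have "(x \<bullet> (?r *\<^sub>R \<xi>)) * exp (t * a) \<le> ?u x * exp (t * (\<phi> x - a)) * exp (t * a)"
          by (rule mult_right_mono) simp
        also have "\<dots> = ?u x * exp (t * \<phi> x)"
          by (simp add: exp_add[symmetric] algebra_simps)
        finally show "x \<bullet> ((?r * exp (t * a)) *\<^sub>R \<xi>) \<le> ?u x * exp (t * \<phi> x)"
          by (simp add: algebra_simps)
      qed
      then have "?r * exp (t * a) \<le> ?r' t"
        by (rule radial_upper[OF K'(1,3) \<xi>])
      then have "exp (t * a) \<le> ?r' t / ?r"
        using r by (simp add: field_simps)
      then have "t * a \<le> ln (?r' t / ?r)"
        using r pos[OF t(1)] by (simp add: ln_ge_iff)
      then show ?thesis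
        using t by (simp add: log_rate_def field_simps)
    qed
    have "0 < d / (U * L)" using d U L by simp
    then show "\<forall>\<^sub>F t in at_right 0. a0 < log_rate K \<phi> t \<xi>"
      using lower a(1) unfolding eventually_at_right_field
      by (intro exI[of _ "d / (U * L)"]) (auto intro: less_le_trans)
  qed
qed

section \<open>The class of admissible integrands\<close>

lemma class_GI0_values:
  fixes G :: "real \<Rightarrow> 'a::euclidean_space \<Rightarrow> real"
  assumes G: "G \<in> class_GI0" and \<xi>: "\<xi> \<in> sphere 0 1"
  shows GI0_zero: "G 0 \<xi> = 0"
    and GI0_nonneg: "0 \<le> z \<Longrightarrow> 0 \<le> G z \<xi>"
    and z_deriv_pos: "0 < z \<Longrightarrow> 0 < z_deriv G z \<xi>"
    and z_deriv_nonneg: "0 \<le> z \<Longrightarrow> 0 \<le> z_deriv G z \<xi>"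
    and GI0_DERIV: "0 < z \<Longrightarrow> ((\<lambda>s. G s \<xi>) has_real_derivative deriv (\<lambda>s. G s \<xi>) z) (at z)"
proof -
  show "G 0 \<xi> = 0" "0 \<le> z \<Longrightarrow> 0 \<le> G z \<xi>"
    using G \<xi> by (auto simp: class_GI0_def)
  show pos: "0 < z_deriv G z \<xi>" if "0 < z" for z
    using G \<xi> that by (auto simp: class_GI0_def z_deriv_def)
  show "0 \<le> z \<Longrightarrow> 0 \<le> z_deriv G z \<xi>"
    using pos[of z] by (cases "z = 0") (auto simp: z_deriv_def)
  show "0 < z \<Longrightarrow> ((\<lambda>s. G s \<xi>) has_real_derivative deriv (\<lambda>s. G s \<xi>) z) (at z)"
    using G \<xi> by (auto simp: class_GI0_def DERIV_deriv_iff_real_differentiable)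
qed

lemma GI0_continuous_on:
  fixes G :: "real \<Rightarrow> 'a::euclidean_space \<Rightarrow> real"
  assumes G: "G \<in> class_GI0" and \<xi>: "\<xi> \<in> sphere 0 1"
  shows "continuous_on {0..} (\<lambda>z. G z \<xi>)"
proof -
  have "continuous_on ({0..} \<times> sphere 0 1) (\<lambda>(z, \<xi>). G z \<xi>)"
    using G by (simp add: class_GI0_def)
  then have "continuous_on {0..} (\<lambda>z. (\<lambda>(z, \<xi>). G z \<xi>) (z, \<xi>))"
    by (rule continuous_on_compose2) (use \<xi> in \<open>auto intro!: continuous_intros\<close>)
  then show ?thesis by simp
qed

lemma GI0_strict_mono:
  fixes G :: "real \<Rightarrow> 'a::euclidean_space \<Rightarrow> real"
  assumes G: "G \<in> class_GI0" and \<xi>: "\<xi> \<in> sphere 0 1" and "0 \<le> a" "a < b"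
  shows "G a \<xi> < G b \<xi>"
proof (rule DERIV_pos_imp_increasing_open[OF \<open>a < b\<close>])
  fix z assume "a < z"
  then show "\<exists>y. ((\<lambda>s. G s \<xi>) has_real_derivative y) (at z) \<and> 0 < y"
    using GI0_DERIV[OF G \<xi>, of z] G \<xi> \<open>0 \<le> a\<close> by (auto simp: class_GI0_def)
next
  show "continuous_on {a..b} (\<lambda>s. G s \<xi>)"
    by (rule continuous_on_subset[OF GI0_continuous_on[OF G \<xi>]]) (use \<open>0 \<le> a\<close> in auto)
qed

lemma GI0_mono:
  fixes G :: "real \<Rightarrow> 'a::euclidean_space \<Rightarrow> real"
  assumes "G \<in> class_GI0" "\<xi> \<in> sphere 0 1" "0 \<le> a" "a \<le> b"
  shows "G a \<xi> \<le> G b \<xi>"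
  using GI0_strict_mono[OF assms(1-3), of b] assms(4) by (cases "a = b") auto

text \<open>In the logarithmic variable the derivative is \<open>z G\<^sub>z\<close>, which is continuous up to \<open>z = 0\<close>, whereas \<open>G\<^sub>z\<close> may be
unbounded there.\<close>

lemma GI0_exp_DERIV:
  fixes G :: "real \<Rightarrow> 'a::euclidean_space \<Rightarrow> real"
  assumes G: "G \<in> class_GI0" and \<xi>: "\<xi> \<in> sphere 0 1" and "0 < a"
  shows "((\<lambda>s. G (a * exp s) \<xi>) has_real_derivative z_deriv G (a * exp s) \<xi>) (at s)"
proof -
  have "((\<lambda>s. G (a * exp s) \<xi>) has_real_derivative deriv (\<lambda>s. G s \<xi>) (a * exp s) * (a * exp s)) (at s)"
    by (rule DERIV_chain2[where f="\<lambda>s. G s \<xi>"])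
      (use GI0_DERIV[OF G \<xi>, of "a * exp s"] \<open>0 < a\<close> in \<open>auto intro!: derivative_eq_intros\<close>)
  then show ?thesis by (simp add: z_deriv_def mult.commute)
qed

lemma bounded_on_slab:
  fixes F :: "real \<Rightarrow> 'a::euclidean_space \<Rightarrow> real"
  assumes "continuous_on ({0..} \<times> sphere 0 1) (\<lambda>(z, \<xi>). F z \<xi>)"
  shows "\<exists>C\<ge>0. \<forall>z\<in>{0..R}. \<forall>\<xi>\<in>sphere 0 1. \<bar>F z \<xi>\<bar> \<le> C"
proof -
  have "continuous_on ({0..R} \<times> sphere 0 1) (\<lambda>(z, \<xi>). F z \<xi>)"
    by (rule continuous_on_subset[OF assms]) auto
  then have "bounded ((\<lambda>(z, \<xi>). F z \<xi>) ` ({0..R} \<times> sphere 0 1))"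
    by (intro compact_imp_bounded compact_continuous_image compact_Times compact_Icc compact_sphere)
  then obtain C where "C > 0" "\<forall>y\<in>(\<lambda>(z, \<xi>). F z \<xi>) ` ({0..R} \<times> sphere 0 1). norm y \<le> C"
    unfolding bounded_pos by blast
  then show ?thesis by (intro exI[of _ C]) (auto simp del: mem_sphere)
qed

lemma GI0_quotient_bound:
  fixes G :: "real \<Rightarrow> 'a::euclidean_space \<Rightarrow> real"
  assumes G: "G \<in> class_GI0" and \<xi>: "\<xi> \<in> sphere 0 1" and a: "0 \<le> a" "a \<le> R"
    and C: "\<forall>z\<in>{0..R * exp M}. \<bar>z_deriv G z \<xi>\<bar> \<le> C"
    and t: "0 < t" "t \<le> 1" and e: "\<bar>e\<bar> \<le> M" and "0 \<le> C"
  shows "\<bar>(G (a * exp (t * e)) \<xi> - G a \<xi>) / t\<bar> \<le> C * M"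
proof (cases "a = 0")
  case True
  then show ?thesis using e \<open>0 \<le> C\<close> by simp
next
  case False
  with a have a': "0 < a" by simp
  have te: "\<bar>t * e\<bar> \<le> M"
    using t e mult_mono[of t 1 "\<bar>e\<bar>" M] by (simp add: abs_mult)
  have "norm (G (a * exp (t * e)) \<xi> - G (a * exp 0) \<xi>) \<le> C * norm (t * e - 0)"
  proof (rule field_differentiable_bound[of "{-M..M}"])
    fix s assume s: "s \<in> {-M..M}"
    show "((\<lambda>s. G (a * exp s) \<xi>) has_field_derivative z_deriv G (a * exp s) \<xi>) (at s within {-M..M})"
      by (rule has_field_derivative_at_within[OF GI0_exp_DERIV[OF G \<xi> a']])
    have "a * exp s \<le> R * exp M"
      using s a by (intro mult_mono) auto
    then show "norm (z_deriv G (a * exp s) \<xi>) \<le> C"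
      using C a' by simp
  qed (use te e in auto)
  then have "\<bar>G (a * exp (t * e)) \<xi> - G a \<xi>\<bar> \<le> C * (t * \<bar>e\<bar>)"
    using t by (simp add: abs_mult)
  also have "\<dots> \<le> C * (t * M)"
    using e t \<open>0 \<le> C\<close> by (intro mult_left_mono) auto
  finally show ?thesis
    using t by (simp add: field_simps)
qed

lemma GI0_quotient_tendsto:
  fixes G :: "real \<Rightarrow> 'a::euclidean_space \<Rightarrow> real"
  assumes G: "G \<in> class_GI0" and \<xi>: "\<xi> \<in> sphere 0 1" and a: "0 < a"
    and t: "t \<longlonglongrightarrow> 0" "\<And>n. 0 < t n" and e: "e \<longlonglongrightarrow> l"
  shows "(\<lambda>n. (G (a * exp (t n * e n)) \<xi> - G a \<xi>) / t n) \<longlonglongrightarrow> z_deriv G a \<xi> * l"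
proof -
  have "((\<lambda>s. G (a * exp s) \<xi>) has_real_derivative z_deriv G a \<xi>) (at 0)"
    using GI0_exp_DERIV[OF G \<xi> a, of 0] by simp
  then obtain h where h: "\<And>s. G (a * exp s) \<xi> - G (a * exp 0) \<xi> = h s * (s - 0)"
    "isCont h 0" "h 0 = z_deriv G a \<xi>"
    unfolding CARAT_DERIV by blast
  have "(\<lambda>n. t n * e n) \<longlonglongrightarrow> 0 * l"
    by (intro tendsto_intros t e)
  then have "(\<lambda>n. h (t n * e n) * e n) \<longlonglongrightarrow> h 0 * l"
    using h(2) by (intro tendsto_mult isCont_tendsto_compose[of 0 h] e) auto
  moreover have "(G (a * exp (t n * e n)) \<xi> - G a \<xi>) / t n = h (t n * e n) * e n" for n
    using h(1)[of "t n * e n"] t(2)[of n] by simp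
  ultimately show ?thesis by (simp add: h(3))
qed

section \<open>Measurability and integrals on the sphere\<close>

lemma sphere_measurable_ident:
  assumes "sets M = sets (sphere_borel :: 'a::euclidean_space measure)"
  shows "(\<lambda>x. x) \<in> borel_measurable M"
  by (subst measurable_cong_sets[OF assms refl]) (intro measurable_restrict_space1, simp)

lemma space_sphere_measure:
  assumes "sets M = sets (sphere_borel :: 'a::euclidean_space measure)"
  shows "space M = sphere 0 1"
  using sets_eq_imp_space_eq[OF assms] by (simp add: space_restrict_space)

lemma AE_on_sphere:
  assumes "finite_borel_measure_on_sphere M"
  shows "AE \<xi> in M. \<xi> \<in> sphere 0 1"
proof -
  have "space M = sphere 0 1"
    using assms by (simp add: finite_borel_measure_on_sphere_def space_sphere_measure)
  then show ?thesis using AE_space[of M] by simp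
qed

lemma sphere_borel_subset_iff:
  assumes "sets M = sets (sphere_borel :: 'a::euclidean_space measure)"
  shows "A \<in> sets M \<longleftrightarrow> A \<in> sets borel \<and> A \<subseteq> sphere 0 1"
  unfolding assms by (subst sets_restrict_space_iff) auto

lemma measurable_on_sphere:
  assumes "sets M = sets (sphere_borel :: 'a::euclidean_space measure)"
    and "continuous_on (sphere 0 1) f"
  shows "f \<in> borel_measurable M"
  by (subst measurable_cong_sets[OF assms(1) refl]) (rule borel_measurable_continuous_on_restrict[OF assms(2)])

lemma measurable_on_slab:
  fixes F :: "real \<Rightarrow> 'a::euclidean_space \<Rightarrow> real"
  assumes F: "continuous_on ({0..} \<times> sphere 0 1) (\<lambda>(z, \<xi>). F z \<xi>)"
    and M: "sets M = sets (sphere_borel :: 'a measure)"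
    and a: "a \<in> borel_measurable M" "\<And>\<xi>. \<xi> \<in> sphere 0 1 \<Longrightarrow> 0 \<le> a \<xi>"
  shows "(\<lambda>\<xi>. F (a \<xi>) \<xi>) \<in> borel_measurable M"
proof -
  have "(\<lambda>\<xi>. (a \<xi>, \<xi>)) \<in> measurable M (restrict_space borel ({0..} \<times> sphere 0 1))"
  proof (rule measurable_restrict_space2)
    show "(\<lambda>\<xi>. (a \<xi>, \<xi>)) \<in> space M \<rightarrow> {0..} \<times> sphere 0 1"
      using a(2) by (auto simp: space_sphere_measure[OF M])
    show "(\<lambda>\<xi>. (a \<xi>, \<xi>)) \<in> borel_measurable M"
      using a(1) sphere_measurable_ident[OF M] by (rule borel_measurable_Pair)
  qed
  from measurable_compose[OF this borel_measurable_continuous_on_restrict[OF F]]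
  show ?thesis by simp
qed

lemma borel_measurable_radial:
  fixes K :: "'a::euclidean_space set"
  assumes K: "compact K" "convex K" "0 \<in> K" and M: "sets M = sets (sphere_borel :: 'a measure)"
  shows "radial_function K \<in> borel_measurable M"
  unfolding borel_measurable_iff_ge
proof
  fix a
  have "{\<xi> \<in> sphere 0 1. a \<le> radial_function K \<xi>} \<in> sets borel"
  proof (cases "0 \<le> a")
    case True
    have "{\<xi> \<in> sphere 0 1. a \<le> radial_function K \<xi>} = sphere 0 1 \<inter> (\<lambda>\<xi>. a *\<^sub>R \<xi>) -` K"
      using scaled_mem_iff_le_radial[OF K _ True] by auto
    moreover have "closed ((\<lambda>\<xi>. a *\<^sub>R \<xi>) -` K)"
      using K by (intro continuous_closed_vimage compact_imp_closed) simp_all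
    ultimately show ?thesis by (simp add: borel_closed closed_Int)
  next
    case False
    then have "{\<xi> \<in> sphere 0 1. a \<le> radial_function K \<xi>} = sphere 0 1"
      using radial_nonneg[OF K(1,3)] by force
    then show ?thesis by simp
  qed
  then show "{\<xi> \<in> space M. a \<le> radial_function K \<xi>} \<in> sets M"
    unfolding space_sphere_measure[OF M] sphere_borel_subset_iff[OF M] by blast
qed

lemma borel_measurable_support:
  fixes K :: "'a::euclidean_space set"
  assumes "compact K" "0 \<in> K" "sets M = sets (sphere_borel :: 'a measure)"
  shows "support_function K \<in> borel_measurable M"
  using assms by (intro measurable_on_sphere continuous_on_support)

lemma integrable_on_slab:
  fixes F :: "real \<Rightarrow> 'a::euclidean_space \<Rightarrow> real"
  assumes F: "continuous_on ({0..} \<times> sphere 0 1) (\<lambda>(z, \<xi>). F z \<xi>)"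
    and M: "finite_borel_measure_on_sphere M"
    and a: "a \<in> borel_measurable M" "\<And>\<xi>. \<xi> \<in> sphere 0 1 \<Longrightarrow> 0 \<le> a \<xi>"
      "\<And>\<xi>. \<xi> \<in> sphere 0 1 \<Longrightarrow> a \<xi> \<le> R"
  shows "integrable M (\<lambda>\<xi>. F (a \<xi>) \<xi>)"
proof -
  have sets: "sets M = sets sphere_borel" and fin: "finite_measure M"
    using M by (auto simp: finite_borel_measure_on_sphere_def)
  obtain C where C: "\<forall>z\<in>{0..R}. \<forall>\<xi>\<in>sphere 0 1. \<bar>F z \<xi>\<bar> \<le> C"
    using bounded_on_slab[OF F] by blast
  show ?thesis
  proof (rule finite_measure.integrable_const_bound[OF fin, where B=C])
    show "AE x in M. norm (F (a x) x) \<le> C"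
      using C a by (intro AE_I2) (simp add: space_sphere_measure[OF sets])
    show "(\<lambda>\<xi>. F (a \<xi>) \<xi>) \<in> borel_measurable M"
      using measurable_on_slab[OF F sets a(1,2)] .
  qed
qed

lemma class_GI0_continuous:
  assumes "G \<in> class_GI0"
  shows "continuous_on ({0..} \<times> sphere 0 1) (\<lambda>(z, \<xi>). G z \<xi>)"
    and "continuous_on ({0..} \<times> sphere 0 1) (\<lambda>(z, \<xi>). z_deriv G z \<xi>)"
  using assms by (auto simp: class_GI0_def)

text \<open>Differentiation under the integral sign along \<open>a exp (t e)\<close>, common to the dual volume (\<open>a\<close> the radial
function) and the energy (\<open>a\<close> the support function). Where \<open>a\<close> vanishes the integrands do not change, so
the limit \<open>l\<close> of \<open>e\<close> enters only where \<open>a\<close> is positive.\<close>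

lemma GI0_integral_variation:
  fixes G :: "real \<Rightarrow> 'a::euclidean_space \<Rightarrow> real"
  assumes G: "G \<in> class_GI0" and M: "finite_borel_measure_on_sphere M"
    and a: "a \<in> borel_measurable M" "\<And>\<xi>. \<xi> \<in> sphere 0 1 \<Longrightarrow> 0 \<le> a \<xi>"
      "\<And>\<xi>. \<xi> \<in> sphere 0 1 \<Longrightarrow> a \<xi> \<le> R"
    and t: "t \<longlonglongrightarrow> 0" "\<And>n. 0 < t n" "\<And>n. t n \<le> 1"
    and e: "\<And>n. e n \<in> borel_measurable M" "\<And>n \<xi>. \<xi> \<in> sphere 0 1 \<Longrightarrow> \<bar>e n \<xi>\<bar> \<le> B"
    and l: "l \<in> borel_measurable M" "AE \<xi> in M. 0 < a \<xi> \<longrightarrow> (\<lambda>n. e n \<xi>) \<longlonglongrightarrow> l \<xi>"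
  shows "(\<lambda>n. ((\<integral>\<xi>. G (a \<xi> * exp (t n * e n \<xi>)) \<xi> \<partial>M) - (\<integral>\<xi>. G (a \<xi>) \<xi> \<partial>M)) / t n)
    \<longlonglongrightarrow> (\<integral>\<xi>. z_deriv G (a \<xi>) \<xi> * l \<xi> \<partial>M)"
proof -
  have sets: "sets M = sets sphere_borel" and fin: "finite_measure M"
    using M by (auto simp: finite_borel_measure_on_sphere_def)
  note sp = space_sphere_measure[OF sets]
  note cont = class_GI0_continuous[OF G]
  obtain C where C: "0 \<le> C" "\<forall>z\<in>{0..R * exp B}. \<forall>\<xi>\<in>sphere 0 1. \<bar>z_deriv G z \<xi>\<bar> \<le> C"
    using bounded_on_slab[OF cont(2)] by blast
  have te: "t n * e n \<xi> \<le> B" if \<xi>: "\<xi> \<in> sphere 0 1" for n \<xi>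
  proof -
    have "t n * e n \<xi> \<le> t n * \<bar>e n \<xi>\<bar>"
      using t(2)[of n] by (intro mult_left_mono) auto
    also have "\<dots> \<le> 1 * B"
      using t(2,3)[of n] e(2)[OF \<xi>, of n] by (intro mult_mono) auto
    finally show ?thesis by simp
  qed
  have intG: "integrable M (\<lambda>\<xi>. G (a \<xi>) \<xi>)"
    using integrable_on_slab[OF cont(1) M a] .
  have m: "(\<lambda>\<xi>. a \<xi> * exp (t n * e n \<xi>)) \<in> borel_measurable M" for n
    using a(1) e(1)[of n] by measurable
  have intGn: "integrable M (\<lambda>\<xi>. G (a \<xi> * exp (t n * e n \<xi>)) \<xi>)" for n
  proof (rule integrable_on_slab[OF cont(1) M m])
    fix \<xi> :: 'a assume \<xi>: "\<xi> \<in> sphere 0 1"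
    show "0 \<le> a \<xi> * exp (t n * e n \<xi>)"
      using a(2)[OF \<xi>] by simp
    show "a \<xi> * exp (t n * e n \<xi>) \<le> R * exp B"
      using a(2,3)[OF \<xi>] te[OF \<xi>] by (intro mult_mono) auto
  qed
  have "(\<lambda>n. \<integral>\<xi>. (G (a \<xi> * exp (t n * e n \<xi>)) \<xi> - G (a \<xi>) \<xi>) / t n \<partial>M)
    \<longlonglongrightarrow> (\<integral>\<xi>. z_deriv G (a \<xi>) \<xi> * l \<xi> \<partial>M)"
  proof (rule integral_dominated_convergence[where w="\<lambda>_. C * B"])
    show "(\<lambda>\<xi>. z_deriv G (a \<xi>) \<xi> * l \<xi>) \<in> borel_measurable M"
      using measurable_on_slab[OF cont(2) sets a(1,2)] l(1) by simp
    show "(\<lambda>\<xi>. (G (a \<xi> * exp (t n * e n \<xi>)) \<xi> - G (a \<xi>) \<xi>) / t n) \<in> borel_measurable M" for n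
      using borel_measurable_integrable[OF intG] borel_measurable_integrable[OF intGn[of n]] by simp
    show "integrable M (\<lambda>_. C * B)"
      using fin by (simp add: finite_measure.integrable_const)
    have "AE \<xi> in M. \<xi> \<in> sphere 0 1"
      using AE_space[of M] by (simp add: sp)
    with l(2) show "AE \<xi> in M. (\<lambda>n. (G (a \<xi> * exp (t n * e n \<xi>)) \<xi> - G (a \<xi>) \<xi>) / t n)
        \<longlonglongrightarrow> z_deriv G (a \<xi>) \<xi> * l \<xi>"
    proof eventually_elim
      case (elim \<xi>)
      show ?case
      proof (cases "a \<xi> = 0")
        case True
        then show ?thesis by (simp add: z_deriv_def)
      next
        case False
        then have "0 < a \<xi>" using a(2)[OF elim(2)] by simp
        with elim show ?thesis
          by (intro GI0_quotient_tendsto[OF G] t) auto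
      qed
    qed
    show "AE \<xi> in M. norm ((G (a \<xi> * exp (t n * e n \<xi>)) \<xi> - G (a \<xi>) \<xi>) / t n) \<le> C * B" for n
    proof (rule AE_I2)
      fix \<xi> assume "\<xi> \<in> space M"
      then have \<xi>: "\<xi> \<in> sphere 0 1" by (simp add: sp)
      then have C': "\<forall>z\<in>{0..R * exp B}. \<bar>z_deriv G z \<xi>\<bar> \<le> C"
        using C(2) by blast
      show "norm ((G (a \<xi> * exp (t n * e n \<xi>)) \<xi> - G (a \<xi>) \<xi>) / t n) \<le> C * B"
        using GI0_quotient_bound[OF G \<xi> a(2,3)[OF \<xi>] C' t(2,3) e(2)[OF \<xi>] C(1)] by simp
    qed
  qed
  moreover have "(\<integral>\<xi>. (G (a \<xi> * exp (t n * e n \<xi>)) \<xi> - G (a \<xi>) \<xi>) / t n \<partial>M)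
    = ((\<integral>\<xi>. G (a \<xi> * exp (t n * e n \<xi>)) \<xi> \<partial>M) - (\<integral>\<xi>. G (a \<xi>) \<xi> \<partial>M)) / t n" for n
    using intG intGn[of n] by simp
  ultimately show ?thesis by (simp only:)
qed

section \<open>Existence of an energy minimizer\<close>

definition dual_volume :: "(real \<Rightarrow> 'a::euclidean_space \<Rightarrow> real) \<Rightarrow> 'a measure \<Rightarrow> 'a set \<Rightarrow> real" where
  "dual_volume G \<kappa> K = (\<integral>\<xi>. G (radial_function K \<xi>) \<xi> \<partial>\<kappa>)"

definition energy :: "(real \<Rightarrow> 'a::euclidean_space \<Rightarrow> real) \<Rightarrow> 'a measure \<Rightarrow> 'a set \<Rightarrow> real" where
  "energy \<Psi> \<mu> K = (\<integral>x. \<Psi> (support_function K x) x \<partial>\<mu>)"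

lemma integrable_energy:
  fixes K :: "'a::euclidean_space set"
  assumes \<Psi>: "\<Psi> \<in> class_GI0" and \<mu>: "finite_borel_measure_on_sphere \<mu>" and K: "compact K" "0 \<in> K"
  shows "integrable \<mu> (\<lambda>x. \<Psi> (support_function K x) x)"
proof -
  obtain R where R: "R > 0" "K \<subseteq> cball 0 R" using compact_in_cball[OF K(1)] .
  have "sets \<mu> = sets sphere_borel" using \<mu> by (simp add: finite_borel_measure_on_sphere_def)
  then show ?thesis
    using support_nonneg[OF K] support_le[OF K(2) R(2)]
    by (intro integrable_on_slab[OF class_GI0_continuous(1)[OF \<Psi>] \<mu>] borel_measurable_support K) auto
qed

lemma integrable_dual_volume:
  fixes K :: "'a::euclidean_space set"
  assumes G: "G \<in> class_GI0" and \<kappa>: "finite_borel_measure_on_sphere \<kappa>"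
    and K: "compact K" "convex K" "0 \<in> K"
  shows "integrable \<kappa> (\<lambda>\<xi>. G (radial_function K \<xi>) \<xi>)"
proof -
  obtain R where R: "R > 0" "K \<subseteq> cball 0 R" using compact_in_cball[OF K(1)] .
  have "sets \<kappa> = sets sphere_borel" using \<kappa> by (simp add: finite_borel_measure_on_sphere_def)
  then show ?thesis
    using radial_nonneg[OF K(1,3)] radial_le[OF K(1,3) R(2)]
    by (intro integrable_on_slab[OF class_GI0_continuous(1)[OF G] \<kappa>] borel_measurable_radial K) auto
qed

lemma energy_nonneg:
  fixes K :: "'a::euclidean_space set"
  assumes \<Psi>: "\<Psi> \<in> class_GI0" and \<mu>: "finite_borel_measure_on_sphere \<mu>" and K: "compact K" "0 \<in> K"
  shows "0 \<le> energy \<Psi> \<mu> K"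
proof -
  have "space \<mu> = sphere 0 1"
    using \<mu> by (simp add: finite_borel_measure_on_sphere_def space_sphere_measure)
  then show ?thesis
    unfolding energy_def using GI0_nonneg[OF \<Psi>] support_nonneg[OF K]
    by (intro Bochner_Integration.integral_nonneg) auto
qed

text \<open>Suppose that there are points \<open>y\<^sub>n\<close> in bodies of bounded energy with norms tending to infinity. A subsequence
of their directions converges to some \<open>v\<close>, and for each \<open>x\<close> with \<open>v \<bullet> x > 0\<close> the support functions at \<open>x\<close>, being
at least \<open>x \<bullet> y\<^sub>n\<close>, tend to infinity. As the open hemisphere around \<open>v\<close> has positive measure, Fatou's lemma
contradicts the bound on the energy.\<close>

lemma energy_coercive:
  fixes \<Psi> :: "real \<Rightarrow> 'a::euclidean_space \<Rightarrow> real"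
  assumes \<Psi>: "\<Psi> \<in> class_GI0" and \<mu>: "finite_borel_measure_on_sphere \<mu>"
    and lim: "\<forall>x\<in>sphere 0 1. filterlim (\<lambda>s. \<Psi> s x) at_top at_top"
    and nonconc: "\<not> concentrated_on_closed_hemisphere \<mu>"
  shows "\<exists>R>0. \<forall>K. compact K \<longrightarrow> 0 \<in> K \<longrightarrow> energy \<Psi> \<mu> K \<le> m \<longrightarrow> K \<subseteq> cball 0 R"
proof (rule ccontr)
  assume neg: "\<not> ?thesis"
  have sets: "sets \<mu> = sets sphere_borel" using \<mu> by (simp add: finite_borel_measure_on_sphere_def)
  note sp = space_sphere_measure[OF sets]
  have "\<exists>K y. compact K \<and> 0 \<in> K \<and> energy \<Psi> \<mu> K \<le> m \<and> y \<in> K \<and> norm y > real (Suc n)" for n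
  proof -
    have "\<not> (\<forall>K. compact K \<longrightarrow> 0 \<in> K \<longrightarrow> energy \<Psi> \<mu> K \<le> m \<longrightarrow> K \<subseteq> cball 0 (real (Suc n)))"
      using neg by (metis of_nat_0_less_iff zero_less_Suc)
    then show ?thesis by (auto simp: subset_iff not_le)
  qed
  then obtain K y where K: "\<And>n. compact (K n)" "\<And>n. 0 \<in> K n" "\<And>n. energy \<Psi> \<mu> (K n) \<le> m"
    and y: "\<And>n. y n \<in> K n" "\<And>n. norm (y n) > real (Suc n)"
    by metis
  have y0: "y n \<noteq> 0" for n using y(2)[of n] by auto
  then have "sgn (y n) \<in> sphere 0 1" for n by (simp add: norm_sgn)
  then obtain v s where v: "v \<in> sphere (0::'a) 1" and s: "strict_mono (s :: nat \<Rightarrow> nat)"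
    and conv: "((\<lambda>n. sgn (y n)) \<circ> s) \<longlonglongrightarrow> v"
    using compact_sphere[of "0::'a" 1] unfolding compact_def by metis
  define f where "f n x = ennreal (\<Psi> (support_function (K (s n)) x) x)" for n x
  have fm: "f n \<in> borel_measurable \<mu>" for n
    unfolding f_def using borel_measurable_integrable[OF integrable_energy[OF \<Psi> \<mu> K(1,2)]] by simp
  have "liminf (\<lambda>n. f n x) = \<infinity>" if x: "x \<in> sphere 0 1" "v \<bullet> x > 0" for x
  proof -
    have "filterlim (\<lambda>n. norm (y (s n)) * (sgn (y (s n)) \<bullet> x)) at_top sequentially"
    proof (rule filterlim_at_top_mult_tendsto_pos[OF _ x(2)])
      show "(\<lambda>n. sgn (y (s n)) \<bullet> x) \<longlonglongrightarrow> v \<bullet> x"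
        using conv by (intro tendsto_intros) (simp add: o_def)
      show "filterlim (\<lambda>n. norm (y (s n))) at_top sequentially"
      proof (rule filterlim_at_top_mono[OF filterlim_real_sequentially])
        show "\<forall>\<^sub>F n in sequentially. real n \<le> norm (y (s n))"
        proof (rule always_eventually, rule allI)
          fix n
          have "n \<le> s n" using s by (rule seq_suble)
          then show "real n \<le> norm (y (s n))" using y(2)[of "s n"] by linarith
        qed
      qed
    qed
    then have "filterlim (\<lambda>n. support_function (K (s n)) x) at_top sequentially"
    proof (rule filterlim_at_top_mono, intro always_eventually allI)
      fix n
      have "norm (y (s n)) * (sgn (y (s n)) \<bullet> x) = x \<bullet> y (s n)"
        using y0 by (simp add: sgn_div_norm inner_commute)
      then show "norm (y (s n)) * (sgn (y (s n)) \<bullet> x) \<le> support_function (K (s n)) x"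
        using support_upper[OF K(1,2) y(1)] by simp
    qed
    then have "filterlim (\<lambda>n. \<Psi> (support_function (K (s n)) x) x) at_top sequentially"
      by (rule filterlim_compose[OF bspec[OF lim x(1)]])
    then have "(\<lambda>n. f n x) \<longlonglongrightarrow> \<infinity>"
      unfolding f_def infinity_ennreal_def ennreal_tendsto_top_eq_at_top .
    then show ?thesis by (intro lim_imp_Liminf) auto
  qed
  let ?P = "{x \<in> sphere 0 1. v \<bullet> x > 0}"
  have P: "?P \<in> sets \<mu>"
  proof -
    have "?P = sphere 0 1 \<inter> {x. v \<bullet> x > 0}" by auto
    moreover have "open {x. v \<bullet> x > 0}"
      by (intro open_Collect_less continuous_intros)
    ultimately show ?thesis
      unfolding sphere_borel_subset_iff[OF sets] by (auto simp: borel_open)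
  qed
  have "\<infinity> * emeasure \<mu> ?P = (\<integral>\<^sup>+x. \<infinity> * indicator ?P x \<partial>\<mu>)"
    using P by (simp add: nn_integral_cmult_indicator)
  also have "\<dots> \<le> (\<integral>\<^sup>+x. liminf (\<lambda>n. f n x) \<partial>\<mu>)"
    using \<open>\<And>x. _ \<Longrightarrow> _ \<Longrightarrow> liminf (\<lambda>n. f n x) = \<infinity>\<close>
    by (intro nn_integral_mono) (auto simp: indicator_def)
  also have "\<dots> \<le> liminf (\<lambda>n. \<integral>\<^sup>+x. f n x \<partial>\<mu>)"
    by (rule nn_integral_liminf[OF fm])
  also have "\<dots> \<le> liminf (\<lambda>n. ennreal m)"
  proof (intro Liminf_mono always_eventually allI)
    fix n
    have "(\<integral>\<^sup>+x. f n x \<partial>\<mu>) = ennreal (energy \<Psi> \<mu> (K (s n)))"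
      unfolding f_def energy_def
      by (intro nn_integral_eq_integral integrable_energy \<Psi> \<mu> K AE_I2)
        (auto simp: sp intro!: GI0_nonneg[OF \<Psi>] support_nonneg K)
    then show "(\<integral>\<^sup>+x. f n x \<partial>\<mu>) \<le> ennreal m"
      using K(3) by (simp add: ennreal_leI)
  qed
  also have "\<dots> < \<infinity>" by (simp add: Liminf_const)
  finally have "emeasure \<mu> ?P = 0"
    by (metis ennreal_top_mult infinity_ennreal_def less_irrefl)
  moreover have "?P = sphere 0 1 - {x \<in> sphere 0 1. (- v) \<bullet> x \<ge> 0}" by auto
  moreover have "- v \<in> sphere 0 1" using v by simp
  ultimately show False
    using nonconc unfolding concentrated_on_closed_hemisphere_def by metis
qed

text \<open>This is as much of Blaschke's selection theorem as the minimization requires: the limit body is the Wulff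
shape of the limit \<open>g\<close> of the support functions, and one-sided estimates suffice. Its support function is at
most \<open>g\<close>. If \<open>a \<xi>\<close> lies in infinitely many of the bodies, then \<open>x \<bullet> a \<xi> \<le> g x\<close> for all \<open>x\<close>, so \<open>a \<xi>\<close> lies in the
limit body; this bounds the upper limit of the radial functions. The maximum with the limit radial
function turns that bound into a convergence.\<close>

lemma limit_body:
  fixes K :: "nat \<Rightarrow> 'a::euclidean_space set"
  assumes K: "\<And>n. compact (K n)" "\<And>n. convex (K n)" "\<And>n. 0 \<in> K n" "\<And>n. K n \<subseteq> cball 0 R"
    and "0 \<le> R"
  obtains L g s where "compact L" "convex L" "0 \<in> L" "strict_mono (s :: nat \<Rightarrow> nat)"
    and "continuous_on (sphere 0 1) g" "\<And>x. x \<in> sphere 0 1 \<Longrightarrow> g x \<in> {0..R}"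
    and "\<And>x. x \<in> sphere 0 1 \<Longrightarrow> (\<lambda>n. support_function (K (s n)) x) \<longlonglongrightarrow> g x"
    and "\<And>x. x \<in> sphere 0 1 \<Longrightarrow> support_function L x \<le> g x"
    and "\<And>\<xi>. \<xi> \<in> sphere 0 1 \<Longrightarrow>
      (\<lambda>n. max (radial_function (K (s n)) \<xi>) (radial_function L \<xi>)) \<longlonglongrightarrow> radial_function L \<xi>"
proof -
  obtain g s where g: "continuous_on (sphere 0 1) g" and s: "strict_mono (s :: nat \<Rightarrow> nat)"
    and unif: "\<And>e. 0 < e \<Longrightarrow> \<exists>N. \<forall>n x. n \<ge> N \<and> x \<in> sphere (0::'a) 1 \<longrightarrow> norm (support_function (K (s n)) x - g x) < e"
  proof (rule Arzela_Ascoli[of "sphere (0::'a) 1" "\<lambda>n. support_function (K n)" R])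
    note conclusion = that
    show thesis if "continuous_on (sphere 0 1) g" "strict_mono k"
      "\<And>e. 0 < e \<Longrightarrow> \<exists>N. \<forall>n x. n \<ge> N \<and> x \<in> sphere (0::'a) 1 \<longrightarrow> norm (support_function (K (k n)) x - g x) < e"
      for g and k :: "nat \<Rightarrow> nat"
      using that by (rule conclusion) 
  next
    fix n and x :: 'a assume "x \<in> sphere 0 1"
    then show "norm (support_function (K n) x) \<le> R"
      using support_nonneg[OF K(1,3), of n x] support_le[OF K(3,4), of x n] by simp
  next
    fix x :: 'a and e :: real assume "x \<in> sphere 0 1" "0 < e"
    have "norm (support_function (K n) x - support_function (K n) y) < e"
      if "norm (x - y) < e / (R + 1)" for n y
    proof -
      have "norm (support_function (K n) x - support_function (K n) y) \<le> R * norm (x - y)"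
        using support_lipschitz[OF K(1,3,4)] by simp
      also have "\<dots> \<le> (R + 1) * norm (x - y)"
        by (intro mult_right_mono) auto
      also have "\<dots> < e"
        using that \<open>0 \<le> R\<close> by (simp add: field_simps)
      finally show ?thesis .
    qed
    moreover have "0 < e / (R + 1)" using \<open>0 < e\<close> \<open>0 \<le> R\<close> by simp
    ultimately show "\<exists>d. 0 < d \<and> (\<forall>n y. y \<in> sphere 0 1 \<and> norm (x - y) < d \<longrightarrow>
        norm (support_function (K n) x - support_function (K n) y) < e)"
      by blast
  qed simp
  have conv: "(\<lambda>n. support_function (K (s n)) x) \<longlonglongrightarrow> g x" if "x \<in> sphere 0 1" for x
    using unif that unfolding LIMSEQ_iff by blast
  have g_range: "g x \<in> {0..R}" if x: "x \<in> sphere 0 1" for x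
  proof -
    have "0 \<le> g x"
      by (rule LIMSEQ_le_const[OF conv[OF x]]) (simp add: support_nonneg[OF K(1,3)])
    moreover have "g x \<le> R"
      by (rule LIMSEQ_le_const2[OF conv[OF x]]) (simp only: support_le[OF K(3,4) x] simp_thms)
    ultimately show ?thesis by simp
  qed
  define L where "L = wulff g"
  have L: "compact L" "convex L" "0 \<in> L"
    unfolding L_def using g_range \<open>0 \<le> R\<close>
    by (auto intro!: compact_wulff[of g R] convex_wulff zero_in_wulff simp del: mem_sphere)
  have suppL: "support_function L x \<le> g x" if "x \<in> sphere 0 1" for x
    unfolding L_def using g_range that by (intro support_wulff_le) auto
  have "(\<lambda>n. max (radial_function (K (s n)) \<xi>) (radial_function L \<xi>)) \<longlonglongrightarrow> radial_function L \<xi>"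
    if \<xi>: "\<xi> \<in> sphere 0 1" for \<xi>
  proof (rule order_tendstoI)
    fix a assume "a < radial_function L \<xi>"
    then show "\<forall>\<^sub>F n in sequentially. a < max (radial_function (K (s n)) \<xi>) (radial_function L \<xi>)"
      by (intro always_eventually) auto
  next
    fix a assume a: "radial_function L \<xi> < a"
    then have "0 \<le> a" using radial_nonneg[OF L(1,3) \<xi>] by simp
    have "\<forall>\<^sub>F n in sequentially. radial_function (K (s n)) \<xi> < a"
    proof (rule ccontr)
      assume "\<not> ?thesis"
      then have freq: "\<exists>\<^sub>F n in sequentially. a *\<^sub>R \<xi> \<in> K (s n)"
        using scaled_mem_iff_le_radial[OF K(1-3) \<xi> \<open>0 \<le> a\<close>]
        by (simp add: not_eventually not_less)
      have "a *\<^sub>R \<xi> \<in> L"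
        unfolding L_def wulff_def
      proof safe
        fix x :: 'a assume x: "x \<in> sphere 0 1"
        show "x \<bullet> (a *\<^sub>R \<xi>) \<le> g x"
        proof (rule ccontr)
          assume "\<not> ?thesis"
          then have "\<forall>\<^sub>F n in sequentially. support_function (K (s n)) x < x \<bullet> (a *\<^sub>R \<xi>)"
            using order_tendstoD(2)[OF conv[OF x]] by simp
          then have "\<forall>\<^sub>F n in sequentially. a *\<^sub>R \<xi> \<notin> K (s n)"
            by eventually_elim (use support_upper[OF K(1,3)] in \<open>force simp: not_le[symmetric]\<close>)
          with freq show False by (simp add: frequently_def)
        qed
      qed
      then show False using radial_upper[OF L(1,3) \<xi>] a by fastforce
    qed
    then show "\<forall>\<^sub>F n in sequentially. max (radial_function (K (s n)) \<xi>) (radial_function L \<xi>) < a"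
      by eventually_elim (use a in simp)
  qed
  then show thesis
    using that[OF L s g] g_range conv suppL by blast
qed

lemma radial_function_cball:
  fixes \<xi> :: "'a::euclidean_space"
  assumes "\<xi> \<in> sphere 0 1"
  shows "radial_function (cball 0 1) \<xi> = 1"
  using radial_le[of "cball (0::'a) 1" 1 \<xi>] radial_upper[of "cball (0::'a) 1" \<xi> 1] assms by simp

lemma dual_volume_eq_zero_imp:
  fixes K :: "'a::euclidean_space set"
  assumes G: "G \<in> class_GI0" and \<kappa>: "finite_borel_measure_on_sphere \<kappa>"
    and ae: "AE \<xi> in \<kappa>. radial_function K \<xi> = 0"
  shows "dual_volume G \<kappa> K = 0"
proof -
  have "AE \<xi> in \<kappa>. \<xi> \<in> sphere 0 1"
    by (rule AE_on_sphere[OF \<kappa>])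
  with ae have "AE \<xi> in \<kappa>. G (radial_function K \<xi>) \<xi> = 0"
    by eventually_elim (simp add: GI0_zero[OF G])
  then show ?thesis
    unfolding dual_volume_def by (rule integral_eq_zero_AE)
qed

lemma dual_volume_cball_pos:
  fixes G :: "real \<Rightarrow> 'a::euclidean_space \<Rightarrow> real"
  assumes G: "G \<in> class_GI0" and \<kappa>: "finite_borel_measure_on_sphere \<kappa>"
    and nz: "emeasure \<kappa> (sphere 0 1) \<noteq> 0"
  shows "0 < dual_volume G \<kappa> (cball 0 1)"
proof -
  have sp: "space \<kappa> = sphere 0 1"
    using \<kappa> by (simp add: finite_borel_measure_on_sphere_def space_sphere_measure)
  let ?g = "\<lambda>\<xi>. G (radial_function (cball 0 1) \<xi>) \<xi>"
  have pos: "0 < ?g \<xi>" if "\<xi> \<in> sphere 0 1" for \<xi>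
    using GI0_strict_mono[OF G that, of 0 1] GI0_zero[OF G that] that by (simp add: radial_function_cball)
  have int: "integrable \<kappa> ?g"
    by (rule integrable_dual_volume[OF G \<kappa>]) auto
  have nonneg: "AE \<xi> in \<kappa>. 0 \<le> ?g \<xi>"
    using pos by (intro AE_I2) (simp add: sp less_imp_le)
  have "integral\<^sup>L \<kappa> ?g \<noteq> 0"
  proof
    assume "integral\<^sup>L \<kappa> ?g = 0"
    then have "AE \<xi> in \<kappa>. ?g \<xi> = 0"
      using integral_nonneg_eq_0_iff_AE[OF int nonneg] by simp
    then have "AE \<xi> in \<kappa>. False"
      by (rule AE_mp) (use pos in \<open>intro AE_I2, force simp: sp\<close>)
    then have "emeasure \<kappa> (space \<kappa>) = 0"
      using AE_iff_measurable[of "space \<kappa>" \<kappa> "\<lambda>_. False"] by simp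
    then show False using nz by (simp add: sp)
  qed
  moreover have "0 \<le> integral\<^sup>L \<kappa> ?g"
    using nonneg by (rule integral_nonneg_AE)
  ultimately show ?thesis by (simp add: dual_volume_def)
qed

lemma interior_nonempty_of_dual_volume:
  fixes K :: "'a::euclidean_space set"
  assumes G: "G \<in> class_GI0" and \<kappa>: "finite_borel_measure_on_sphere \<kappa>"
    and flat: "\<And>a. a \<noteq> 0 \<Longrightarrow> AE \<xi> in \<kappa>. a \<bullet> \<xi> \<noteq> 0"
    and K: "compact K" "convex K" "0 \<in> K" and V: "0 < dual_volume G \<kappa> K"
  shows "interior K \<noteq> {}"
proof
  assume "interior K = {}"
  then obtain a b where ab: "a \<noteq> 0" "K \<subseteq> {x. a \<bullet> x = b}"
    using empty_interior_subset_hyperplane[OF K(2)] by blast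
  then have b: "b = 0" using K(3) by auto
  have "AE \<xi> in \<kappa>. \<xi> \<in> sphere 0 1"
    by (rule AE_on_sphere[OF \<kappa>])
  with flat[OF ab(1)] have "AE \<xi> in \<kappa>. radial_function K \<xi> = 0"
  proof eventually_elim
    case (elim \<xi>)
    have "a \<bullet> (radial_function K \<xi> *\<^sub>R \<xi>) = 0"
      using radial_in[OF K(1,3) elim(2)] ab(2) b by blast
    then show ?case using elim(1) by simp
  qed
  then show False
    using dual_volume_eq_zero_imp[OF G \<kappa>] V by simp
qed

text \<open>The direct method, with the dual volume of the unit ball as lower bound for the dual volume. This bound is
positive, which excludes limit bodies in a hyperplane. A body whose dual volume is at least that of the
minimizer is admissible as well; the variation of the minimizer uses the minimality in this form.\<close>

lemma exists_energy_minimizer: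
  fixes G \<Psi> :: "real \<Rightarrow> 'a::euclidean_space \<Rightarrow> real"
  assumes G: "G \<in> class_GI0" and \<Psi>: "\<Psi> \<in> class_GI0"
    and \<kappa>: "finite_borel_measure_on_sphere \<kappa>" and nz: "emeasure \<kappa> (sphere 0 1) \<noteq> 0"
    and flat: "\<And>a. a \<noteq> 0 \<Longrightarrow> AE \<xi> in \<kappa>. a \<bullet> \<xi> \<noteq> 0"
    and \<mu>: "finite_borel_measure_on_sphere \<mu>"
    and lim: "\<forall>x\<in>sphere 0 1. filterlim (\<lambda>s. \<Psi> s x) at_top at_top"
    and nonconc: "\<not> concentrated_on_closed_hemisphere \<mu>"
  obtains K where "compact K" "convex K" "0 \<in> K" "interior K \<noteq> {}" "0 < dual_volume G \<kappa> K"
    and "\<And>L. compact L \<Longrightarrow> convex L \<Longrightarrow> 0 \<in> L \<Longrightarrow>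
      dual_volume G \<kappa> K \<le> dual_volume G \<kappa> L \<Longrightarrow> energy \<Psi> \<mu> K \<le> energy \<Psi> \<mu> L"
proof -
  have sets\<kappa>: "sets \<kappa> = sets sphere_borel" and sets\<mu>: "sets \<mu> = sets sphere_borel"
    using \<kappa> \<mu> by (auto simp: finite_borel_measure_on_sphere_def)
  note sp\<kappa> = space_sphere_measure[OF sets\<kappa>] and sp\<mu> = space_sphere_measure[OF sets\<mu>]
  note contG = class_GI0_continuous(1)[OF G] and cont\<Psi> = class_GI0_continuous(1)[OF \<Psi>]
  define c where "c = dual_volume G \<kappa> (cball 0 1)"
  have c: "0 < c" unfolding c_def by (rule dual_volume_cball_pos[OF G \<kappa> nz])
  define admissible where
    "admissible K \<longleftrightarrow> compact K \<and> convex K \<and> 0 \<in> K \<and> c \<le> dual_volume G \<kappa> K" for K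
  define I where "I = Inf (energy \<Psi> \<mu> ` Collect admissible)"
  have ne: "Collect admissible \<noteq> {}"
    using c_def by (auto simp: admissible_def intro!: exI[of _ "cball 0 1"])
  have bdd: "bdd_below (energy \<Psi> \<mu> ` Collect admissible)"
    using energy_nonneg[OF \<Psi> \<mu>] by (intro bdd_belowI[of _ 0]) (auto simp: admissible_def)
  have I_le: "I \<le> energy \<Psi> \<mu> L" if "admissible L" for L
    unfolding I_def using bdd that by (intro cINF_lower) auto
  have "\<exists>K. admissible K \<and> energy \<Psi> \<mu> K < I + 1 / real (Suc n)" for n
  proof -
    have "Inf (energy \<Psi> \<mu> ` Collect admissible) < I + 1 / real (Suc n)"
      by (simp add: I_def)
    then show ?thesis using cINF_less_iff[OF ne bdd] by auto
  qed
  then obtain K where K: "\<And>n. admissible (K n)" "\<And>n. energy \<Psi> \<mu> (K n) < I + 1 / real (Suc n)"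
    by metis
  have K': "compact (K n)" "convex (K n)" "0 \<in> K n" "c \<le> dual_volume G \<kappa> (K n)" for n
    using K(1)[of n] by (auto simp: admissible_def)
  obtain R where R: "R > 0" "\<And>L. compact L \<Longrightarrow> 0 \<in> L \<Longrightarrow> energy \<Psi> \<mu> L \<le> I + 1 \<Longrightarrow> L \<subseteq> cball 0 R"
    using energy_coercive[OF \<Psi> \<mu> lim nonconc, of "I + 1"] by blast
  have bound: "K n \<subseteq> cball 0 R" for n
  proof (rule R(2)[OF K'(1,3)])
    have "1 / real (Suc n) \<le> 1" by simp
    then show "energy \<Psi> \<mu> (K n) \<le> I + 1" using K(2)[of n] by linarith
  qed
  obtain L g s where L: "compact L" "convex L" "0 \<in> L" and s: "strict_mono (s :: nat \<Rightarrow> nat)"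
    and g: "continuous_on (sphere 0 1) g" "\<And>x. x \<in> sphere 0 1 \<Longrightarrow> g x \<in> {0..R}"
      "\<And>x. x \<in> sphere 0 1 \<Longrightarrow> (\<lambda>n. support_function (K (s n)) x) \<longlonglongrightarrow> g x"
      "\<And>x. x \<in> sphere 0 1 \<Longrightarrow> support_function L x \<le> g x"
    and rad: "\<And>\<xi>. \<xi> \<in> sphere 0 1 \<Longrightarrow>
      (\<lambda>n. max (radial_function (K (s n)) \<xi>) (radial_function L \<xi>)) \<longlonglongrightarrow> radial_function L \<xi>"
    using limit_body[of K R] K'(1-3) bound R(1) less_imp_le by metis
  have g_meas: "g \<in> borel_measurable \<mu>"
    by (rule measurable_on_sphere[OF sets\<mu> g(1)])
  have int_g: "integrable \<mu> (\<lambda>x. \<Psi> (g x) x)"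
    using g(2) by (intro integrable_on_slab[OF cont\<Psi> \<mu> g_meas, of R]) auto
  have compose: "(\<lambda>n. F (z n) x) \<longlonglongrightarrow> F l x"
    if F: "F \<in> class_GI0" and x: "x \<in> sphere 0 1" and z: "z \<longlonglongrightarrow> l" "\<And>n. 0 \<le> z n" "0 \<le> l"
    for F :: "real \<Rightarrow> 'a \<Rightarrow> real" and z l x
    by (rule continuous_on_tendsto_compose[OF GI0_continuous_on[OF F x] z(1)]) (use z in auto)
  obtain D where D: "\<forall>z\<in>{0..R}. \<forall>x\<in>sphere 0 1. \<bar>\<Psi> z x\<bar> \<le> D"
    using bounded_on_slab[OF cont\<Psi>] by blast
  obtain C where C: "\<forall>z\<in>{0..R}. \<forall>x\<in>sphere 0 1. \<bar>G z x\<bar> \<le> C"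
    using bounded_on_slab[OF contG] by blast
  have fin: "finite_measure \<kappa>" "finite_measure \<mu>"
    using \<kappa> \<mu> by (auto simp: finite_borel_measure_on_sphere_def)

  \<comment> \<open>The energy of the limit body: it is at most the energy of \<open>g\<close>, which is the infimum.\<close>
  have "(\<lambda>n. energy \<Psi> \<mu> (K (s n))) \<longlonglongrightarrow> (\<integral>x. \<Psi> (g x) x \<partial>\<mu>)"
    unfolding energy_def
  proof (rule integral_dominated_convergence[where w="\<lambda>_. D"])
    show "(\<lambda>x. \<Psi> (g x) x) \<in> borel_measurable \<mu>"
      using int_g by simp
    show "(\<lambda>x. \<Psi> (support_function (K (s n)) x) x) \<in> borel_measurable \<mu>" for n
      using integrable_energy[OF \<Psi> \<mu> K'(1,3)] by simp
    show "integrable \<mu> (\<lambda>_. D)"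
      using fin(2) by (simp add: finite_measure.integrable_const)
    show "AE x in \<mu>. (\<lambda>n. \<Psi> (support_function (K (s n)) x) x) \<longlonglongrightarrow> \<Psi> (g x) x"
    proof (rule AE_I2)
      fix x assume "x \<in> space \<mu>"
      then have x: "x \<in> sphere 0 1" by (simp add: sp\<mu>)
      show "(\<lambda>n. \<Psi> (support_function (K (s n)) x) x) \<longlonglongrightarrow> \<Psi> (g x) x"
        using g(2)[OF x] by (intro compose[OF \<Psi> x g(3)[OF x]] support_nonneg K') auto
    qed
    show "AE x in \<mu>. norm (\<Psi> (support_function (K (s n)) x) x) \<le> D" for n
    proof (rule AE_I2)
      fix x assume "x \<in> space \<mu>"
      then have x: "x \<in> sphere 0 1" by (simp add: sp\<mu>)
      then show "norm (\<Psi> (support_function (K (s n)) x) x) \<le> D"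
        using D support_le[OF K'(3) bound x] support_nonneg[OF K'(1,3)] by simp
    qed
  qed
  moreover have "(\<lambda>n. energy \<Psi> \<mu> (K (s n))) \<longlonglongrightarrow> I"
  proof -
    have "(\<lambda>n. energy \<Psi> \<mu> (K n)) \<longlonglongrightarrow> I"
    proof (rule tendsto_sandwich)
      show "\<forall>\<^sub>F n in sequentially. I \<le> energy \<Psi> \<mu> (K n)"
        using I_le K(1) by simp
      show "\<forall>\<^sub>F n in sequentially. energy \<Psi> \<mu> (K n) \<le> I + 1 / real (Suc n)"
        using K(2) by (simp add: less_imp_le)
      show "(\<lambda>n. I + 1 / real (Suc n)) \<longlonglongrightarrow> I"
        using tendsto_add[OF tendsto_const[of I] LIMSEQ_inverse_real_of_nat] by (simp add: inverse_eq_divide)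
    qed simp
    then show ?thesis
      using LIMSEQ_subseq_LIMSEQ[OF _ s] by (simp add: o_def)
  qed
  ultimately have "(\<integral>x. \<Psi> (g x) x \<partial>\<mu>) = I"
    by (rule LIMSEQ_unique)
  moreover have "energy \<Psi> \<mu> L \<le> (\<integral>x. \<Psi> (g x) x \<partial>\<mu>)"
    unfolding energy_def
  proof (rule integral_mono[OF integrable_energy[OF \<Psi> \<mu> L(1,3)] int_g])
    fix x assume "x \<in> space \<mu>"
    then have x: "x \<in> sphere 0 1" by (simp add: sp\<mu>)
    show "\<Psi> (support_function L x) x \<le> \<Psi> (g x) x"
      by (rule GI0_mono[OF \<Psi> x support_nonneg[OF L(1,3)] g(4)[OF x]])
  qed
  ultimately have energy_L: "energy \<Psi> \<mu> L \<le> I" by simp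

  \<comment> \<open>The dual volume of the limit body: enlarging the radial functions to the maxima \<open>?m\<close> keeps the lower
    bound \<open>c\<close> and makes them converge.\<close>
  let ?m = "\<lambda>n \<xi>. max (radial_function (K (s n)) \<xi>) (radial_function L \<xi>)"
  have r_bounds: "0 \<le> radial_function (K n) \<xi>" "radial_function (K n) \<xi> \<le> R" if "\<xi> \<in> sphere 0 1" for n \<xi>
    using radial_nonneg[OF K'(1,3) that] radial_le[OF K'(1,3) bound that] by auto
  have L_nonneg: "0 \<le> radial_function L \<xi>" if "\<xi> \<in> sphere 0 1" for \<xi>
    using radial_nonneg[OF L(1,3) that] .
  have L_le: "radial_function L \<xi> \<le> R" if "\<xi> \<in> sphere 0 1" for \<xi>
  proof -
    have "support_function L \<xi> \<le> R" using g(2,4)[OF that] by simp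
    moreover have "\<xi> \<bullet> (radial_function L \<xi> *\<^sub>R \<xi>) \<le> support_function L \<xi>"
      by (rule support_upper[OF L(1,3) radial_in[OF L(1,3) that]])
    ultimately show ?thesis using that by (simp add: dot_square_norm)
  qed
  have int_m: "integrable \<kappa> (\<lambda>\<xi>. G (?m n \<xi>) \<xi>)" for n
  proof (rule integrable_on_slab[OF contG \<kappa>, of _ R])
    show "?m n \<in> borel_measurable \<kappa>"
      by (intro borel_measurable_max borel_measurable_radial K' L sets\<kappa>)
  qed (use r_bounds L_nonneg L_le in \<open>auto simp: le_max_iff_disj simp del: mem_sphere mem_sphere_0\<close>)
  have "(\<lambda>n. \<integral>\<xi>. G (?m n \<xi>) \<xi> \<partial>\<kappa>) \<longlonglongrightarrow> dual_volume G \<kappa> L"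
    unfolding dual_volume_def
  proof (rule integral_dominated_convergence[where w="\<lambda>_. C"])
    show "(\<lambda>\<xi>. G (radial_function L \<xi>) \<xi>) \<in> borel_measurable \<kappa>"
      using integrable_dual_volume[OF G \<kappa> L] by simp
    show "(\<lambda>\<xi>. G (?m n \<xi>) \<xi>) \<in> borel_measurable \<kappa>" for n
      using int_m by (rule borel_measurable_integrable)
    show "integrable \<kappa> (\<lambda>_. C)"
      using fin(1) by (simp add: finite_measure.integrable_const)
    show "AE \<xi> in \<kappa>. (\<lambda>n. G (?m n \<xi>) \<xi>) \<longlonglongrightarrow> G (radial_function L \<xi>) \<xi>"
    proof (rule AE_I2)
      fix \<xi> assume "\<xi> \<in> space \<kappa>"
      then have \<xi>: "\<xi> \<in> sphere 0 1" by (simp add: sp\<kappa>)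
      show "(\<lambda>n. G (?m n \<xi>) \<xi>) \<longlonglongrightarrow> G (radial_function L \<xi>) \<xi>"
        by (rule compose[OF G \<xi> rad[OF \<xi>]]) (use L_nonneg[OF \<xi>] in \<open>auto simp: le_max_iff_disj\<close>)
    qed
    show "AE \<xi> in \<kappa>. norm (G (?m n \<xi>) \<xi>) \<le> C" for n
    proof (rule AE_I2)
      fix \<xi> assume "\<xi> \<in> space \<kappa>"
      then have \<xi>: "\<xi> \<in> sphere 0 1" by (simp add: sp\<kappa>)
      have "?m n \<xi> \<in> {0..R}"
        using r_bounds[OF \<xi>] L_nonneg[OF \<xi>] L_le[OF \<xi>] by (simp add: le_max_iff_disj)
      then show "norm (G (?m n \<xi>) \<xi>) \<le> C"
        using C \<xi> by (metis real_norm_def)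
    qed
  qed
  moreover have "c \<le> (\<integral>\<xi>. G (?m n \<xi>) \<xi> \<partial>\<kappa>)" for n
  proof -
    have "c \<le> dual_volume G \<kappa> (K (s n))" by (rule K'(4))
    also have "\<dots> \<le> (\<integral>\<xi>. G (?m n \<xi>) \<xi> \<partial>\<kappa>)"
      unfolding dual_volume_def
    proof (rule integral_mono[OF integrable_dual_volume[OF G \<kappa> K'(1-3)] int_m])
      fix \<xi> assume "\<xi> \<in> space \<kappa>"
      then have \<xi>: "\<xi> \<in> sphere 0 1" by (simp add: sp\<kappa>)
      show "G (radial_function (K (s n)) \<xi>) \<xi> \<le> G (?m n \<xi>) \<xi>"
        by (rule GI0_mono[OF G \<xi> r_bounds(1)[OF \<xi>]]) simp
    qed
    finally show ?thesis .
  qed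
  ultimately have V: "c \<le> dual_volume G \<kappa> L"
    by (intro LIMSEQ_le_const) auto
  then have V_pos: "0 < dual_volume G \<kappa> L" using c by simp
  show thesis
  proof (rule that[OF L interior_nonempty_of_dual_volume[OF G \<kappa> flat L V_pos] V_pos])
    fix L' assume "compact L'" "convex L'" "0 \<in> L'" "dual_volume G \<kappa> L \<le> dual_volume G \<kappa> L'"
    then have "admissible L'" using V by (simp add: admissible_def)
    then show "energy \<Psi> \<mu> L \<le> energy \<Psi> \<mu> L'"
      using I_le energy_L by (meson order_trans)
  qed
qed

section \<open>First variation and the Euler-Lagrange equation\<close>

text \<open>The directions with a normal in a closed set \<open>C\<close> form the preimage of a closed set \<open>P\<close> under the measurable
map \<open>\<xi> \<mapsto> r(\<xi>) \<xi>\<close>. Outside the set \<open>D\<close> of good directions the selection takes a constant value.\<close>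

lemma measurable_normal_selection:
  fixes K :: "'a::euclidean_space set"
  assumes K: "compact K" "convex K" "0 \<in> K" and M: "sets M = sets (sphere_borel :: 'a measure)"
    and ae: "AE \<xi> in M. radial_function K \<xi> > 0 \<longrightarrow>
      (\<exists>x. normals K \<xi> = {x} \<and> support_function K x > 0)"
  shows "\<exists>\<alpha>. \<alpha> \<in> borel_measurable M \<and> (\<forall>\<xi>. \<alpha> \<xi> \<in> sphere 0 1) \<and>
    (AE \<xi> in M. radial_function K \<xi> > 0 \<longrightarrow> normals K \<xi> = {\<alpha> \<xi>} \<and> support_function K (\<alpha> \<xi>) > 0)"
proof -
  note sp = space_sphere_measure[OF M]
  let ?r = "radial_function K"
  let ?good = "\<lambda>\<xi>. ?r \<xi> > 0 \<longrightarrow> (\<exists>x. normals K \<xi> = {x} \<and> support_function K x > 0)"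
  obtain N where N: "{\<xi> \<in> space M. \<not> ?good \<xi>} \<subseteq> N" "emeasure M N = 0" "N \<in> sets M"
    using AE_E[OF ae] by blast
  obtain x1 :: 'a where x1: "x1 \<in> sphere 0 1"
    using nonempty_Basis norm_Basis by fastforce
  define D where "D = {\<xi> \<in> space M. 0 < ?r \<xi>} - N"
  have D: "D \<in> sets M"
    using N(3) borel_measurable_radial[OF K M] unfolding D_def by measurable
  have good: "\<exists>x. normals K \<xi> = {x} \<and> support_function K x > 0" if "\<xi> \<in> D" for \<xi>
    using that N(1) by (auto simp: D_def)
  define \<alpha> where "\<alpha> \<xi> = (if \<xi> \<in> D then the_elem (normals K \<xi>) else x1)" for \<xi>
  have \<alpha>: "normals K \<xi> = {\<alpha> \<xi>} \<and> support_function K (\<alpha> \<xi>) > 0" if "\<xi> \<in> D" for \<xi>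
  proof -
    obtain x where "normals K \<xi> = {x}" "support_function K x > 0"
      using good[OF \<open>\<xi> \<in> D\<close>] by blast
    then show ?thesis using \<open>\<xi> \<in> D\<close> by (simp add: \<alpha>_def)
  qed
  have "\<alpha> \<xi> \<in> sphere 0 1" for \<xi>
  proof (cases "\<xi> \<in> D")
    case True
    then have "\<alpha> \<xi> \<in> normals K \<xi>" using \<alpha> by blast
    then show ?thesis by (simp add: normals_def)
  qed (use x1 in \<open>simp add: \<alpha>_def\<close>)
  moreover have "AE \<xi> in M. ?r \<xi> > 0 \<longrightarrow> normals K \<xi> = {\<alpha> \<xi>} \<and> support_function K (\<alpha> \<xi>) > 0"
  proof (rule AE_I'[of N])
    show "N \<in> null_sets M" using N by (simp add: null_sets_def)
    show "{\<xi> \<in> space M. \<not> (?r \<xi> > 0 \<longrightarrow> normals K \<xi> = {\<alpha> \<xi>} \<and> support_function K (\<alpha> \<xi>) > 0)} \<subseteq> N"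
    proof safe
      fix \<xi> assume "\<xi> \<in> space M" "\<xi> \<notin> N" "0 < ?r \<xi>"
      then have "\<xi> \<in> D" by (simp add: D_def)
      note \<alpha>[OF this]
      then show "x \<in> normals K \<xi> \<Longrightarrow> x = \<alpha> \<xi>" "\<alpha> \<xi> \<in> normals K \<xi>" "0 < support_function K (\<alpha> \<xi>)" for x
        by blast+
    qed
  qed
  moreover have "\<alpha> \<in> borel_measurable M"
    unfolding borel_eq_closed
  proof (rule measurable_measure_of)
    fix C :: "'a set" assume "C \<in> Collect closed"
    then have C: "closed C" by simp
    define P where "P = {y. \<exists>x. x \<in> sphere 0 1 \<inter> C \<and> (x, y) \<in> {z. fst z \<bullet> snd z = support_function K (fst z)}}"
    define h where "h \<xi> = ?r \<xi> *\<^sub>R \<xi>" for \<xi>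
    have "closed {z :: 'a \<times> 'a. fst z \<bullet> snd z = support_function K (fst z)}"
      by (intro closed_Collect_eq continuous_intros continuous_on_compose2[OF continuous_on_support[OF K(1,3)]]) auto
    moreover have "compact (sphere 0 1 \<inter> C)" using C by (simp add: compact_Int_closed)
    ultimately have "closed P"
      unfolding P_def by (rule closed_compact_projection[rotated])
    then have P: "P \<in> sets borel" by (rule borel_closed)
    have "h \<in> borel_measurable M"
      unfolding h_def
      using borel_measurable_radial[OF K M] sphere_measurable_ident[OF M] by (rule borel_measurable_scaleR)
    from measurable_sets[OF this P]
    have Q: "h -` P \<inter> space M \<in> sets M" .
    have in_D: "\<alpha> \<xi> \<in> C \<longleftrightarrow> h \<xi> \<in> P" if "\<xi> \<in> D" for \<xi>
    proof -
      have "h \<xi> \<in> P \<longleftrightarrow> normals K \<xi> \<inter> C \<noteq> {}"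
        unfolding normals_def P_def h_def by auto
      also have "normals K \<xi> = {\<alpha> \<xi>}"
        using \<alpha>[OF that] by blast
      finally show ?thesis by simp
    qed
    have not_D: "\<alpha> \<xi> = x1" if "\<xi> \<notin> D" for \<xi>
      using that by (simp add: \<alpha>_def)
    have "\<alpha> -` C \<inter> space M = (D \<inter> (h -` P \<inter> space M)) \<union> (if x1 \<in> C then space M - D else {})"
    proof (intro set_eqI)
      fix \<xi>
      show "\<xi> \<in> \<alpha> -` C \<inter> space M \<longleftrightarrow>
          \<xi> \<in> (D \<inter> (h -` P \<inter> space M)) \<union> (if x1 \<in> C then space M - D else {})"
        by (cases "\<xi> \<in> D") (simp_all add: in_D not_D)
    qed
    also have "\<dots> \<in> sets M" using D Q by auto
    finally show "\<alpha> -` C \<inter> space M \<in> sets M" .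
  qed simp_all
  ultimately show ?thesis by blast
qed

lemma borel_measurable_log_rate:
  fixes K :: "'a::euclidean_space set"
  assumes K: "compact K" "convex K" "0 \<in> K" and M: "sets M = sets (sphere_borel :: 'a measure)"
    and \<phi>: "\<forall>x\<in>sphere 0 1. \<bar>\<phi> x\<bar> \<le> B" and t: "0 \<le> t" and B: "0 \<le> B"
  shows "log_rate K \<phi> t \<in> borel_measurable M"
proof -
  note P = perturbed_body[OF K \<phi> t B]
  have "radial_function K \<in> borel_measurable M"
    "radial_function (perturbed K \<phi> t) \<in> borel_measurable M"
    using borel_measurable_radial[OF K M] borel_measurable_radial[OF P(1-3) M] by auto
  then have "(\<lambda>\<xi>. ln (radial_function (perturbed K \<phi> t) \<xi> / radial_function K \<xi>) / t) \<in> borel_measurable M"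
    by measurable
  then show ?thesis unfolding log_rate_def[abs_def] .
qed

definition volume_variation ::
  "(real \<Rightarrow> 'a::euclidean_space \<Rightarrow> real) \<Rightarrow> 'a measure \<Rightarrow> 'a set \<Rightarrow> ('a \<Rightarrow> 'a) \<Rightarrow> ('a \<Rightarrow> real) \<Rightarrow> real" where
  "volume_variation G \<kappa> K \<alpha> \<phi> = (\<integral>\<xi>. z_deriv G (radial_function K \<xi>) \<xi> * \<phi> (\<alpha> \<xi>) \<partial>\<kappa>)"

definition energy_variation ::
  "(real \<Rightarrow> 'a::euclidean_space \<Rightarrow> real) \<Rightarrow> 'a measure \<Rightarrow> 'a set \<Rightarrow> ('a \<Rightarrow> real) \<Rightarrow> real" where
  "energy_variation \<Psi> \<mu> K \<phi> = (\<integral>x. z_deriv \<Psi> (support_function K x) x * \<phi> x \<partial>\<mu>)"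

lemma dual_volume_variation:
  fixes G :: "real \<Rightarrow> 'a::euclidean_space \<Rightarrow> real"
  assumes G: "G \<in> class_GI0" and \<kappa>: "finite_borel_measure_on_sphere \<kappa>"
    and K: "compact K" "convex K" "0 \<in> K"
    and \<alpha>: "\<alpha> \<in> borel_measurable \<kappa>"
      "AE \<xi> in \<kappa>. radial_function K \<xi> > 0 \<longrightarrow> normals K \<xi> = {\<alpha> \<xi>} \<and> support_function K (\<alpha> \<xi>) > 0"
    and cont: "continuous_on UNIV \<phi>" and \<phi>: "\<forall>x\<in>sphere 0 1. \<bar>\<phi> x\<bar> \<le> B" and B: "0 \<le> B"
    and t: "t \<longlonglongrightarrow> 0" "\<And>n. 0 < t n" "\<And>n. t n \<le> 1"
  shows "(\<lambda>n. (dual_volume G \<kappa> (perturbed K \<phi> (t n)) - dual_volume G \<kappa> K) / t n)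
    \<longlonglongrightarrow> volume_variation G \<kappa> K \<alpha> \<phi>"
proof -
  have sets: "sets \<kappa> = sets sphere_borel" using \<kappa> by (simp add: finite_borel_measure_on_sphere_def)
  note sp = space_sphere_measure[OF sets]
  let ?r = "radial_function K" and ?e = "\<lambda>n. log_rate K \<phi> (t n)"
  obtain R where R: "R > 0" "K \<subseteq> cball 0 R" using compact_in_cball[OF K(1)] .
  have "(\<lambda>n. ((\<integral>\<xi>. G (?r \<xi> * exp (t n * ?e n \<xi>)) \<xi> \<partial>\<kappa>) - (\<integral>\<xi>. G (?r \<xi>) \<xi> \<partial>\<kappa>)) / t n)
    \<longlonglongrightarrow> (\<integral>\<xi>. z_deriv G (?r \<xi>) \<xi> * \<phi> (\<alpha> \<xi>) \<partial>\<kappa>)"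
  proof (rule GI0_integral_variation[OF G \<kappa> borel_measurable_radial[OF K sets]
        radial_nonneg[OF K(1,3)] radial_le[OF K(1,3) R(2)] t])
    show "?e n \<in> borel_measurable \<kappa>" for n
      by (rule borel_measurable_log_rate[OF K sets \<phi> less_imp_le[OF t(2)] B])
    show "\<bar>?e n \<xi>\<bar> \<le> B" if "\<xi> \<in> sphere 0 1" for n \<xi>
      by (rule log_rate_bound[OF K \<phi> t(2) B that])
    show "(\<lambda>\<xi>. \<phi> (\<alpha> \<xi>)) \<in> borel_measurable \<kappa>"
      using \<alpha>(1) borel_measurable_continuous_onI[OF cont] by (rule measurable_compose)
    show "AE \<xi> in \<kappa>. 0 < ?r \<xi> \<longrightarrow> (\<lambda>n. ?e n \<xi>) \<longlonglongrightarrow> \<phi> (\<alpha> \<xi>)"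
      using \<alpha>(2) AE_on_sphere[OF \<kappa>]
    proof eventually_elim
      case (elim \<xi>)
      show ?case
      proof
        assume r: "0 < ?r \<xi>"
        have "((\<lambda>t. log_rate K \<phi> t \<xi>) \<longlongrightarrow> \<phi> (\<alpha> \<xi>)) (at_right 0)"
          using elim r by (intro log_rate_tendsto[OF K continuous_on_subset[OF cont] \<phi> B elim(2) r]) auto
        moreover have "filterlim t (at_right 0) sequentially"
          using t(1) t(2) by (auto simp: filterlim_at less_imp_neq[OF t(2), symmetric])
        ultimately show "(\<lambda>n. ?e n \<xi>) \<longlonglongrightarrow> \<phi> (\<alpha> \<xi>)"
          by (rule filterlim_compose)
      qed
    qed
  qed auto
  moreover have "(\<integral>\<xi>. G (?r \<xi> * exp (t n * ?e n \<xi>)) \<xi> \<partial>\<kappa>) = dual_volume G \<kappa> (perturbed K \<phi> (t n))" for n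
    unfolding dual_volume_def
  proof (rule Bochner_Integration.integral_cong[OF refl])
    fix \<xi> assume "\<xi> \<in> space \<kappa>"
    then have "\<xi> \<in> sphere 0 1" by (simp add: sp)
    then show "G (?r \<xi> * exp (t n * ?e n \<xi>)) \<xi> = G (radial_function (perturbed K \<phi> (t n)) \<xi>) \<xi>"
      using radial_perturbed_eq[OF K \<phi> t(2) B] by simp
  qed
  ultimately show ?thesis
    by (simp only: volume_variation_def dual_volume_def)
qed

text \<open>Where the dual volume increases to first order, the perturbed bodies are admissible for small \<open>t > 0\<close>. Their
support functions lie below \<open>u exp (t \<phi>)\<close>, so the right derivative of the energy of \<open>u exp (t \<phi>)\<close> cannot be
negative.\<close>

lemma variational_inequality:
  fixes G \<Psi> :: "real \<Rightarrow> 'a::euclidean_space \<Rightarrow> real"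
  assumes G: "G \<in> class_GI0" and \<Psi>: "\<Psi> \<in> class_GI0"
    and \<kappa>: "finite_borel_measure_on_sphere \<kappa>" and \<mu>: "finite_borel_measure_on_sphere \<mu>"
    and K: "compact K" "convex K" "0 \<in> K"
    and min: "\<And>L. compact L \<Longrightarrow> convex L \<Longrightarrow> 0 \<in> L \<Longrightarrow>
      dual_volume G \<kappa> K \<le> dual_volume G \<kappa> L \<Longrightarrow> energy \<Psi> \<mu> K \<le> energy \<Psi> \<mu> L"
    and \<alpha>: "\<alpha> \<in> borel_measurable \<kappa>"
      "AE \<xi> in \<kappa>. radial_function K \<xi> > 0 \<longrightarrow> normals K \<xi> = {\<alpha> \<xi>} \<and> support_function K (\<alpha> \<xi>) > 0"
    and cont: "continuous_on UNIV \<phi>" and \<phi>: "\<forall>x\<in>sphere 0 1. \<bar>\<phi> x\<bar> \<le> B" and B: "0 \<le> B"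
    and pos: "0 < volume_variation G \<kappa> K \<alpha> \<phi>"
  shows "0 \<le> energy_variation \<Psi> \<mu> K \<phi>"
proof -
  have sets: "sets \<mu> = sets sphere_borel" using \<mu> by (simp add: finite_borel_measure_on_sphere_def)
  note sp = space_sphere_measure[OF sets]
  let ?u = "support_function K"
  obtain R where R: "R > 0" "K \<subseteq> cball 0 R" using compact_in_cball[OF K(1)] .
  define t where "t n = inverse (real (Suc n))" for n
  have t: "t \<longlonglongrightarrow> 0" "\<And>n. 0 < t n" "\<And>n. t n \<le> 1"
    unfolding t_def using LIMSEQ_inverse_real_of_nat by (auto simp: field_simps)
  let ?K = "\<lambda>n. perturbed K \<phi> (t n)"
  note P = perturbed_body[OF K \<phi> less_imp_le[OF t(2)] B]
  have \<phi>_meas: "\<phi> \<in> borel_measurable \<mu>"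
    by (rule measurable_on_sphere[OF sets continuous_on_subset[OF cont]]) simp
  have lim: "(\<lambda>n. ((\<integral>x. \<Psi> (?u x * exp (t n * \<phi> x)) x \<partial>\<mu>) - (\<integral>x. \<Psi> (?u x) x \<partial>\<mu>)) / t n)
    \<longlonglongrightarrow> energy_variation \<Psi> \<mu> K \<phi>"
    unfolding energy_variation_def
  proof (rule GI0_integral_variation[OF \<Psi> \<mu> borel_measurable_support[OF K(1,3) sets]
        support_nonneg[OF K(1,3)] support_le[OF K(3) R(2)] t \<phi>_meas _ \<phi>_meas])
    show "\<bar>\<phi> x\<bar> \<le> B" if "x \<in> sphere 0 1" for x using \<phi> that by blast
  qed simp_all
  have "\<forall>\<^sub>F n in sequentially. 0 < (dual_volume G \<kappa> (?K n) - dual_volume G \<kappa> K) / t n"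
    by (rule order_tendstoD(1)[OF dual_volume_variation[OF G \<kappa> K \<alpha> cont \<phi> B t] pos])
  then have "\<forall>\<^sub>F n in sequentially.
    0 \<le> ((\<integral>x. \<Psi> (?u x * exp (t n * \<phi> x)) x \<partial>\<mu>) - (\<integral>x. \<Psi> (?u x) x \<partial>\<mu>)) / t n"
  proof eventually_elim
    case (elim n)
    then have "dual_volume G \<kappa> K \<le> dual_volume G \<kappa> (?K n)"
      using t(2)[of n] by (simp add: zero_less_divide_iff)
    then have "energy \<Psi> \<mu> K \<le> energy \<Psi> \<mu> (?K n)"
      by (rule min[OF P(1-3)])
    also have "\<dots> \<le> (\<integral>x. \<Psi> (?u x * exp (t n * \<phi> x)) x \<partial>\<mu>)"
      unfolding energy_def
    proof (rule integral_mono[OF integrable_energy[OF \<Psi> \<mu> P(1,3)]])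
      show "integrable \<mu> (\<lambda>x. \<Psi> (?u x * exp (t n * \<phi> x)) x)"
      proof (rule integrable_on_slab[OF class_GI0_continuous(1)[OF \<Psi>] \<mu>])
        show "(\<lambda>x. ?u x * exp (t n * \<phi> x)) \<in> borel_measurable \<mu>"
          using borel_measurable_support[OF K(1,3) sets] \<phi>_meas by measurable
        fix x :: 'a assume x: "x \<in> sphere 0 1"
        show "0 \<le> ?u x * exp (t n * \<phi> x)"
          using support_nonneg[OF K(1,3), of x] by simp
        have "t n * \<phi> x \<le> t n * B"
          using \<phi> x t(2)[of n] by (intro mult_left_mono) fastforce+
        then show "?u x * exp (t n * \<phi> x) \<le> R * exp (t n * B)"
          using support_nonneg[OF K(1,3), of x] support_le[OF K(3) R(2) x] R(1) by (intro mult_mono) auto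
      qed
      fix x assume "x \<in> space \<mu>"
      then have x: "x \<in> sphere 0 1" by (simp add: sp)
      show "\<Psi> (support_function (?K n) x) x \<le> \<Psi> (?u x * exp (t n * \<phi> x)) x"
        by (rule GI0_mono[OF \<Psi> x support_nonneg[OF P(1,3)] P(4)[OF x]])
    qed
    finally show ?case
      using t(2)[of n] by (simp add: energy_def)
  qed
  with lim show ?thesis
    by (intro tendsto_lowerbound[OF lim]) auto
qed

text \<open>A Lagrange multiplier rule. Subtracting from \<open>\<phi>\<close> a constant slightly smaller than \<open>A \<phi> / a\<close> makes \<open>A\<close>
positive, so \<open>B \<phi> \<ge> b / a * A \<phi>\<close> in the limit; the same for \<open>- \<phi>\<close> gives equality. Here \<open>a\<close> and \<open>b\<close> stand
for the values of \<open>A\<close> and \<open>B\<close> at the constant function \<open>1\<close>.\<close>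

lemma proportional_if_pos_imp_nonneg:
  fixes A B :: "('a \<Rightarrow> real) \<Rightarrow> real"
  assumes shift: "\<And>\<phi> s. P \<phi> \<Longrightarrow> P (\<lambda>x. \<phi> x - s) \<and> A (\<lambda>x. \<phi> x - s) = A \<phi> - s * a \<and> B (\<lambda>x. \<phi> x - s) = B \<phi> - s * b"
    and neg: "\<And>\<phi>. P \<phi> \<Longrightarrow> P (\<lambda>x. - \<phi> x) \<and> A (\<lambda>x. - \<phi> x) = - A \<phi> \<and> B (\<lambda>x. - \<phi> x) = - B \<phi>"
    and imp: "\<And>\<phi>. P \<phi> \<Longrightarrow> 0 < A \<phi> \<Longrightarrow> 0 \<le> B \<phi>"
    and "0 < a" and "P \<phi>"
  shows "B \<phi> = b / a * A \<phi>"
proof -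
  have ge: "b / a * A \<phi> \<le> B \<phi>" if \<phi>: "P \<phi>" for \<phi>
  proof (rule tendsto_upperbound)
    show "((\<lambda>e. (A \<phi> / a - e) * b) \<longlongrightarrow> b / a * A \<phi>) (at_right 0)"
      by (auto intro!: tendsto_eq_intros)
    show "\<forall>\<^sub>F e in at_right 0. (A \<phi> / a - e) * b \<le> B \<phi>"
      unfolding eventually_at_right_field
    proof (intro exI[of _ 1] conjI allI impI)
      fix e :: real assume "0 < e"
      then have "0 < A \<phi> - (A \<phi> / a - e) * a"
        using \<open>0 < a\<close> by (simp add: algebra_simps)
      then have "0 \<le> B (\<lambda>x. \<phi> x - (A \<phi> / a - e))"
        using shift[OF \<phi>] by (intro imp) auto
      then show "(A \<phi> / a - e) * b \<le> B \<phi>"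
        using shift[OF \<phi>, of "A \<phi> / a - e"] by simp
    qed simp
  qed simp
  have "b / a * A \<phi> \<le> B \<phi>" by (rule ge[OF \<open>P \<phi>\<close>])
  moreover have "b / a * - A \<phi> \<le> - B \<phi>"
    using ge[of "\<lambda>x. - \<phi> x"] neg[OF \<open>P \<phi>\<close>] by simp
  ultimately show ?thesis by simp
qed

lemma integrable_mult_bounded:
  fixes f g :: "'a::euclidean_space \<Rightarrow> real"
  assumes f: "integrable M f" and g: "g \<in> borel_measurable M" and B: "AE x in M. \<bar>g x\<bar> \<le> B"
  shows "integrable M (\<lambda>x. f x * g x)"
proof (rule Bochner_Integration.integrable_bound)
  show "integrable M (\<lambda>x. B * f x)" using f by simp
  show "(\<lambda>x. f x * g x) \<in> borel_measurable M" using f g by simp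
  show "AE x in M. norm (f x * g x) \<le> norm (B * f x)"
    using B
  proof eventually_elim
    case (elim x)
    have "\<bar>g x\<bar> * \<bar>f x\<bar> \<le> \<bar>B\<bar> * \<bar>f x\<bar>"
      using elim by (intro mult_right_mono) auto
    then show ?case by (simp add: abs_mult mult.commute)
  qed
qed

lemma bounded_on_sphere:
  fixes \<phi> :: "'a::euclidean_space \<Rightarrow> real"
  assumes "continuous_on UNIV \<phi>"
  obtains B where "0 \<le> B" "\<forall>x\<in>sphere 0 1. \<bar>\<phi> x\<bar> \<le> B"
proof -
  have "bounded (\<phi> ` sphere 0 1)"
    by (intro compact_imp_bounded compact_continuous_image continuous_on_subset[OF assms]) auto
  then obtain B where "B > 0" "\<forall>y\<in>\<phi> ` sphere 0 1. norm y \<le> B"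
    unfolding bounded_pos by blast
  then show thesis using that[of B] by auto
qed

lemma euler_lagrange_equation:
  fixes G \<Psi> :: "real \<Rightarrow> 'a::euclidean_space \<Rightarrow> real"
  assumes G: "G \<in> class_GI0" and \<Psi>: "\<Psi> \<in> class_GI0"
    and \<kappa>: "finite_borel_measure_on_sphere \<kappa>" and \<mu>: "finite_borel_measure_on_sphere \<mu>"
    and K: "compact K" "convex K" "0 \<in> K"
    and min: "\<And>L. compact L \<Longrightarrow> convex L \<Longrightarrow> 0 \<in> L \<Longrightarrow>
      dual_volume G \<kappa> K \<le> dual_volume G \<kappa> L \<Longrightarrow> energy \<Psi> \<mu> K \<le> energy \<Psi> \<mu> L"
    and \<alpha>: "\<alpha> \<in> borel_measurable \<kappa>" "\<And>\<xi>. \<alpha> \<xi> \<in> sphere 0 1"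
      "AE \<xi> in \<kappa>. radial_function K \<xi> > 0 \<longrightarrow> normals K \<xi> = {\<alpha> \<xi>} \<and> support_function K (\<alpha> \<xi>) > 0"
    and pos: "0 < volume_variation G \<kappa> K \<alpha> (\<lambda>_. 1)"
    and cont: "continuous_on UNIV \<phi>"
  shows "energy_variation \<Psi> \<mu> K \<phi> =
    energy_variation \<Psi> \<mu> K (\<lambda>_. 1) / volume_variation G \<kappa> K \<alpha> (\<lambda>_. 1) * volume_variation G \<kappa> K \<alpha> \<phi>"
proof (rule proportional_if_pos_imp_nonneg[where P="continuous_on UNIV", OF _ _ _ pos cont])
  have sets\<kappa>: "sets \<kappa> = sets sphere_borel" and sets\<mu>: "sets \<mu> = sets sphere_borel"
    using \<kappa> \<mu> by (auto simp: finite_borel_measure_on_sphere_def)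
  obtain R where R: "R > 0" "K \<subseteq> cball 0 R" using compact_in_cball[OF K(1)] .
  have int_G: "integrable \<kappa> (\<lambda>\<xi>. z_deriv G (radial_function K \<xi>) \<xi>)"
    using radial_nonneg[OF K(1,3)] radial_le[OF K(1,3) R(2)]
    by (intro integrable_on_slab[OF class_GI0_continuous(2)[OF G] \<kappa>] borel_measurable_radial K sets\<kappa>)
  have int_\<Psi>: "integrable \<mu> (\<lambda>x. z_deriv \<Psi> (support_function K x) x)"
    using support_nonneg[OF K(1,3)] support_le[OF K(3) R(2)]
    by (intro integrable_on_slab[OF class_GI0_continuous(2)[OF \<Psi>] \<mu>] borel_measurable_support K sets\<mu>)
  fix \<phi> :: "'a \<Rightarrow> real" assume \<phi>: "continuous_on UNIV \<phi>"
  obtain B where B: "0 \<le> B" "\<forall>x\<in>sphere 0 1. \<bar>\<phi> x\<bar> \<le> B" using bounded_on_sphere[OF \<phi>] .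
  have int_A: "integrable \<kappa> (\<lambda>\<xi>. z_deriv G (radial_function K \<xi>) \<xi> * \<phi> (\<alpha> \<xi>))"
  proof (rule integrable_mult_bounded[OF int_G, of _ B])
    show "(\<lambda>\<xi>. \<phi> (\<alpha> \<xi>)) \<in> borel_measurable \<kappa>"
      using \<alpha>(1) borel_measurable_continuous_onI[OF \<phi>] by (rule measurable_compose)
    show "AE \<xi> in \<kappa>. \<bar>\<phi> (\<alpha> \<xi>)\<bar> \<le> B"
      using bspec[OF B(2) \<alpha>(2)] by simp
  qed
  have int_B: "integrable \<mu> (\<lambda>x. z_deriv \<Psi> (support_function K x) x * \<phi> x)"
  proof (rule integrable_mult_bounded[OF int_\<Psi>, of _ B])
    show "\<phi> \<in> borel_measurable \<mu>"
      by (rule measurable_on_sphere[OF sets\<mu> continuous_on_subset[OF \<phi>]]) simp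
    show "AE x in \<mu>. \<bar>\<phi> x\<bar> \<le> B"
      using AE_on_sphere[OF \<mu>] by eventually_elim (rule bspec[OF B(2)])
  qed
  show "continuous_on UNIV (\<lambda>x. \<phi> x - s) \<and>
      volume_variation G \<kappa> K \<alpha> (\<lambda>x. \<phi> x - s) = volume_variation G \<kappa> K \<alpha> \<phi> - s * volume_variation G \<kappa> K \<alpha> (\<lambda>_. 1) \<and>
      energy_variation \<Psi> \<mu> K (\<lambda>x. \<phi> x - s) = energy_variation \<Psi> \<mu> K \<phi> - s * energy_variation \<Psi> \<mu> K (\<lambda>_. 1)" for s
    using \<phi> int_A int_B int_G int_\<Psi>
    by (auto simp: volume_variation_def energy_variation_def right_diff_distrib mult.commute[of _ s]
        intro!: continuous_intros)
  show "continuous_on UNIV (\<lambda>x. - \<phi> x) \<and>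
      volume_variation G \<kappa> K \<alpha> (\<lambda>x. - \<phi> x) = - volume_variation G \<kappa> K \<alpha> \<phi> \<and>
      energy_variation \<Psi> \<mu> K (\<lambda>x. - \<phi> x) = - energy_variation \<Psi> \<mu> K \<phi>"
    using \<phi> by (auto simp: volume_variation_def energy_variation_def intro!: continuous_intros)
  show "0 \<le> energy_variation \<Psi> \<mu> K \<phi>" if "0 < volume_variation G \<kappa> K \<alpha> \<phi>"
    by (rule variational_inequality[OF G \<Psi> \<kappa> \<mu> K min \<alpha>(1,3) \<phi> B(2,1) that])
qed

section \<open>The dual curvature measure as an image measure\<close>

text \<open>The indicator function of a closed set is a pointwise limit of continuous functions with values between
\<open>0\<close> and \<open>1\<close>, and the closed sets are an intersection-stable generator of the Borel sets.\<close>

lemma borel_measure_eqI_continuous: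
  fixes M N :: "'a::metric_space measure"
  assumes M: "sets M = sets borel" "finite_measure M" and N: "sets N = sets borel" "finite_measure N"
    and eq: "\<And>\<phi> :: 'a \<Rightarrow> real. continuous_on UNIV \<phi> \<Longrightarrow> (\<And>x. \<phi> x \<in> {0..1}) \<Longrightarrow>
      (\<integral>x. \<phi> x \<partial>M) = (\<integral>x. \<phi> x \<partial>N)"
  shows "M = N"
proof (rule measure_eqI_generator_eq[where E="Collect closed" and \<Omega>=UNIV and A="\<lambda>_. UNIV"])
  show "Int_stable (Collect (closed :: 'a set \<Rightarrow> bool))"
    by (auto simp: Int_stable_def)
  show "sets M = sigma_sets UNIV (Collect closed)" "sets N = sigma_sets UNIV (Collect closed)"
    using M(1) N(1) by (auto simp: borel_eq_closed)
  show "emeasure M UNIV \<noteq> \<infinity>" for i :: nat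
    using M(2) by (simp add: finite_measure.emeasure_finite)
next
  fix C :: "'a set" assume "C \<in> Collect closed"
  then have C: "closed C" by simp
  show "emeasure M C = emeasure N C"
  proof (cases "C = {}")
    case False
    define \<phi> where "\<phi> n x = max 0 (1 - real n * infdist x C)" for n x
    have cont: "continuous_on UNIV (\<phi> n)" for n
      unfolding \<phi>_def by (intro continuous_intros)
    have range: "\<phi> n x \<in> {0..1}" for n x
      using infdist_nonneg[of x C] by (simp add: \<phi>_def)
    have lim: "(\<lambda>n. \<phi> n x) \<longlonglongrightarrow> indicator C x" for x
    proof (cases "x \<in> C")
      case True
      then show ?thesis by (simp add: \<phi>_def)
    next
      case x: False
      then have d: "0 < infdist x C"
        using C False infdist_pos_not_in_closed by blast
      obtain m where "1 / infdist x C < real m" using reals_Archimedean2 by blast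
      then have "\<phi> n x = 0" if "m \<le> n" for n
      proof -
        have "1 / infdist x C < real n" using \<open>1 / infdist x C < real m\<close> that by linarith
        then show ?thesis using d by (simp add: \<phi>_def field_simps)
      qed
      then have "\<forall>\<^sub>F n in sequentially. \<phi> n x = 0"
        by (auto simp: eventually_sequentially)
      then show ?thesis using x by (simp add: tendsto_eventually)
    qed
    have int: "(\<lambda>n. \<integral>x. \<phi> n x \<partial>Q) \<longlonglongrightarrow> measure Q C"
      if Q: "sets Q = sets borel" "finite_measure Q" for Q
    proof -
      have "(\<lambda>n. \<integral>x. \<phi> n x \<partial>Q) \<longlonglongrightarrow> (\<integral>x. indicator C x \<partial>Q)"
      proof (rule integral_dominated_convergence[where w="\<lambda>_. 1"])
        show "\<phi> n \<in> borel_measurable Q" for n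
          using borel_measurable_continuous_onI[OF cont] by (simp add: measurable_cong_sets[OF Q(1) refl])
        show "(indicator C :: 'a \<Rightarrow> real) \<in> borel_measurable Q"
          using C Q(1) by (intro borel_measurable_indicator) simp
        show "integrable Q (\<lambda>_. 1 :: real)"
          using Q(2) by (simp add: finite_measure.integrable_const)
        show "AE x in Q. (\<lambda>n. \<phi> n x) \<longlonglongrightarrow> indicator C x" using lim by simp
        show "AE x in Q. norm (\<phi> n x) \<le> 1" for n
          using range[of n] by (intro AE_I2) auto
      qed
      then show ?thesis using C Q(1) by simp
    qed
    have "measure M C = measure N C"
      using int[OF M] int[OF N] eq[OF cont range] LIMSEQ_unique by fastforce
    then show ?thesis
      using M(2) N(2) by (simp add: finite_measure.emeasure_eq_measure)
  qed simp
qed auto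

lemma radial_point_in_frontier:
  fixes K :: "'a::euclidean_space set"
  assumes K: "compact K" "0 \<in> K" and \<xi>: "\<xi> \<in> sphere 0 1"
  shows "radial_function K \<xi> *\<^sub>R \<xi> \<in> frontier K"
proof -
  let ?y = "radial_function K \<xi> *\<^sub>R \<xi>"
  have "?y \<notin> interior K"
  proof
    assume "?y \<in> interior K"
    then obtain e where e: "0 < e" "ball ?y e \<subseteq> K"
      unfolding mem_interior by blast
    have "(radial_function K \<xi> + e / 2) *\<^sub>R \<xi> \<in> ball ?y e"
      using e(1) \<xi> by (simp add: dist_norm scaleR_add_left)
    then have "radial_function K \<xi> + e / 2 \<le> radial_function K \<xi>"
      using e(2) by (intro radial_upper[OF K \<xi>]) blast
    then show False using e(1) by simp
  qed
  then show ?thesis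
    using radial_in[OF K \<xi>] closure_subset[of K] by (auto simp: frontier_def)
qed

text \<open>Where \<open>r\<close> vanishes, both integrands do. Elsewhere the only normal is \<open>\<alpha> \<xi>\<close>; it is not in the normal cone at
the origin, because \<open>r \<xi> \<bullet> \<alpha> \<xi> = u (\<alpha> \<xi>) > 0\<close> almost everywhere. So removing that cone from \<open>\<omega>\<close> changes
the domain of integration by a null set.\<close>

lemma dual_curvature_eq:
  fixes K :: "'a::euclidean_space set"
  assumes \<kappa>: "finite_borel_measure_on_sphere \<kappa>" and K: "compact K" "0 \<in> K"
    and \<alpha>: "AE \<xi> in \<kappa>. radial_function K \<xi> > 0 \<longrightarrow> normals K \<xi> = {\<alpha> \<xi>} \<and> support_function K (\<alpha> \<xi>) > 0"
    and \<omega>: "\<omega> \<subseteq> sphere 0 1"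
  shows "dual_curvature G \<kappa> K \<omega> =
    (\<integral>\<^sup>+\<xi>. ennreal (z_deriv G (radial_function K \<xi>) \<xi>) * indicator \<omega> (\<alpha> \<xi>) \<partial>\<kappa>)"
  unfolding dual_curvature_def nn_integral_completion
proof (rule nn_integral_cong_AE)
  show "AE \<xi> in \<kappa>. ennreal (z_deriv G (radial_function K \<xi>) \<xi>) *
      indicator (reverse_radial_gauss K (\<omega> - normal_cone_at_origin K)) \<xi> =
    ennreal (z_deriv G (radial_function K \<xi>) \<xi>) * indicator \<omega> (\<alpha> \<xi>)"
    using \<alpha> AE_on_sphere[OF \<kappa>]
  proof eventually_elim
    case (elim \<xi>)
    let ?r = "radial_function K \<xi>"
    show ?case
    proof (cases "?r = 0")
      case True
      then show ?thesis by (simp add: z_deriv_def)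
    next
      case False
      then have "?r > 0" using radial_nonneg[OF K elim(2)] by simp
      then have normals: "normals K \<xi> = {\<alpha> \<xi>}" and u: "support_function K (\<alpha> \<xi>) > 0"
        using elim(1) by blast+
      have \<alpha>_normal: "\<alpha> \<xi> \<bullet> (?r *\<^sub>R \<xi>) = support_function K (\<alpha> \<xi>)"
        using normals by (auto simp: normals_def)
      have not_cone: "\<alpha> \<xi> \<notin> normal_cone_at_origin K"
      proof
        assume "\<alpha> \<xi> \<in> normal_cone_at_origin K"
        then have "(?r *\<^sub>R \<xi>) \<bullet> \<alpha> \<xi> \<le> 0"
          using radial_in[OF K elim(2)] unfolding normal_cone_at_origin_def by blast
        then show False using \<alpha>_normal u by (simp add: inner_commute)
      qed
      have "\<xi> \<in> reverse_radial_gauss K (\<omega> - normal_cone_at_origin K) \<longleftrightarrow> \<alpha> \<xi> \<in> \<omega>"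
      proof
        assume "\<xi> \<in> reverse_radial_gauss K (\<omega> - normal_cone_at_origin K)"
        then obtain x where x: "x \<in> \<omega>" "x \<bullet> (?r *\<^sub>R \<xi>) = support_function K x"
          by (auto simp: reverse_radial_gauss_def reverse_gauss_def reverse_gauss_point_def)
        then have "x \<in> normals K \<xi>" using \<omega> unfolding normals_def by blast
        then show "\<alpha> \<xi> \<in> \<omega>" using x(1) normals by simp
      next
        assume "\<alpha> \<xi> \<in> \<omega>"
        then show "\<xi> \<in> reverse_radial_gauss K (\<omega> - normal_cone_at_origin K)"
          using \<alpha>_normal not_cone elim(2) radial_point_in_frontier[OF K elim(2)]
          unfolding reverse_radial_gauss_def reverse_gauss_def reverse_gauss_point_def by blast
      qed
      then show ?thesis by (simp add: indicator_def)
    qed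
  qed
qed

theorem theorem1p2:
  fixes G \<Psi> \<psi> :: "real \<Rightarrow> 'a::euclidean_space \<Rightarrow> real"
    and \<mu> \<kappa> :: "'a measure"
    and p :: "'a \<Rightarrow> real"
  assumes "G \<in> class_GI0"
    and "\<Psi> \<in> class_GI0"
    and "\<psi> = z_deriv \<Psi>"
    and "finite_borel_measure_on_sphere \<kappa>"
    and "emeasure \<kappa> (sphere 0 1) \<noteq> 0"
    and "continuous_on (sphere 0 1) p"
    and "\<forall>\<xi> \<in> sphere 0 1. p \<xi> > 0"
    and "\<kappa> = density spherical_measure (\<lambda>\<xi>. ennreal (p \<xi>))"
    and "\<forall>x \<in> sphere 0 1. filterlim (\<lambda>s. \<Psi> s x) at_top at_top"
    and "finite_borel_measure_on_sphere \<mu>"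
    and "emeasure \<mu> (sphere 0 1) \<noteq> 0"
    and "\<not> concentrated_on_closed_hemisphere \<mu>"
  shows "\<exists>\<Omega> \<in> bodies_with_origin. \<exists>\<tau>.
           dual_curvature G \<kappa> \<Omega> (sphere 0 1) \<notin> {0, \<infinity>} \<and>
           \<tau> = (\<integral>\<^sup>+ x. ennreal (\<psi> (support_function \<Omega> x) x) \<partial>\<mu>)
                 / dual_curvature G \<kappa> \<Omega> (sphere 0 1) \<and>
           (\<forall>\<omega> \<in> sets (restrict_space borel (sphere 0 1)).
              (\<integral>\<^sup>+ x \<in> \<omega>. ennreal (\<psi> (support_function \<Omega> x) x) \<partial>\<mu>)
                = \<tau> * dual_curvature G \<kappa> \<Omega> \<omega>)"
proof -
  note G = assms(1) and \<Psi> = assms(2) and \<kappa> = assms(4) and \<mu> = assms(10)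
  have sets\<kappa>: "sets \<kappa> = sets sphere_borel" and sets\<mu>: "sets \<mu> = sets sphere_borel"
    and fin: "finite_measure \<kappa>" "finite_measure \<mu>"
    using \<kappa> \<mu> by (auto simp: finite_borel_measure_on_sphere_def)
  note sp\<kappa> = space_sphere_measure[OF sets\<kappa>] and sp\<mu> = space_sphere_measure[OF sets\<mu>]
  have "p \<in> borel_measurable spherical_measure"
    by (rule measurable_on_sphere[OF sets_spherical_measure assms(6)])
  \<comment> \<open>The measure \<open>\<kappa>\<close> is absolutely continuous with respect to the spherical measure.\<close>
  then have AE_\<kappa>: "AE \<xi> in \<kappa>. Q \<xi>" if "AE \<xi> in spherical_measure. Q \<xi>" for Q
    using that unfolding assms(8) by (subst AE_density) auto
  obtain K where K: "compact K" "convex K" "0 \<in> K" and int: "interior K \<noteq> {}"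
    and V: "0 < dual_volume G \<kappa> K"
    and min: "\<And>L. compact L \<Longrightarrow> convex L \<Longrightarrow> 0 \<in> L \<Longrightarrow>
      dual_volume G \<kappa> K \<le> dual_volume G \<kappa> L \<Longrightarrow> energy \<Psi> \<mu> K \<le> energy \<Psi> \<mu> L"
    using exists_energy_minimizer[OF G \<Psi> \<kappa> assms(5) AE_\<kappa>[OF AE_spherical_measure_hyperplane] \<mu> assms(9,12)]
    by blast
  let ?r = "radial_function K" and ?u = "support_function K"
  define f where "f \<xi> = z_deriv G (?r \<xi>) \<xi>" for \<xi>
  define h where "h x = z_deriv \<Psi> (?u x) x" for x
  obtain \<alpha> where \<alpha>: "\<alpha> \<in> borel_measurable \<kappa>" "\<And>\<xi>. \<alpha> \<xi> \<in> sphere 0 1"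
    "AE \<xi> in \<kappa>. ?r \<xi> > 0 \<longrightarrow> normals K \<xi> = {\<alpha> \<xi>} \<and> ?u (\<alpha> \<xi>) > 0"
    using measurable_normal_selection[OF K sets\<kappa> AE_\<kappa>[OF AE_unique_normal[OF K]]] by blast
  obtain R where R: "R > 0" "K \<subseteq> cball 0 R" using compact_in_cball[OF K(1)] .
  have int_f: "integrable \<kappa> f"
    unfolding f_def using radial_nonneg[OF K(1,3)] radial_le[OF K(1,3) R(2)]
    by (intro integrable_on_slab[OF class_GI0_continuous(2)[OF G] \<kappa>] borel_measurable_radial K sets\<kappa>)
  have int_h: "integrable \<mu> h"
    unfolding h_def using support_nonneg[OF K(1,3)] support_le[OF K(3) R(2)]
    by (intro integrable_on_slab[OF class_GI0_continuous(2)[OF \<Psi>] \<mu>] borel_measurable_support K sets\<mu>)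
  have f_nonneg: "AE \<xi> in \<kappa>. 0 \<le> f \<xi>"
    using AE_on_sphere[OF \<kappa>] by eventually_elim (simp add: f_def z_deriv_nonneg[OF G] radial_nonneg[OF K(1,3)])
  have h_nonneg: "AE x in \<mu>. 0 \<le> h x"
    using AE_on_sphere[OF \<mu>] by eventually_elim (simp add: h_def z_deriv_nonneg[OF \<Psi>] support_nonneg[OF K(1,3)])
  define a where "a = (\<integral>\<xi>. f \<xi> \<partial>\<kappa>)"
  define b where "b = (\<integral>x. h x \<partial>\<mu>)"
  have a1: "a = volume_variation G \<kappa> K \<alpha> (\<lambda>_. 1)" and b1: "b = energy_variation \<Psi> \<mu> K (\<lambda>_. 1)"
    by (simp_all add: a_def b_def f_def h_def volume_variation_def energy_variation_def)
  have "a \<noteq> 0"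
  proof
    assume "a = 0"
    then have "AE \<xi> in \<kappa>. f \<xi> = 0"
      using integral_nonneg_eq_0_iff_AE[OF int_f f_nonneg] by (simp add: a_def)
    with AE_on_sphere[OF \<kappa>] have "AE \<xi> in \<kappa>. ?r \<xi> = 0"
    proof eventually_elim
      case (elim \<xi>)
      then show ?case
        using z_deriv_pos[OF G elim(1), of "?r \<xi>"] radial_nonneg[OF K(1,3) elim(1)] by (force simp: f_def)
    qed
    then show False using dual_volume_eq_zero_imp[OF G \<kappa>] V by simp
  qed
  moreover have "0 \<le> a" unfolding a_def by (rule integral_nonneg_AE[OF f_nonneg])
  ultimately have a: "0 < a" by simp
  have b: "0 \<le> b" unfolding b_def by (rule integral_nonneg_AE[OF h_nonneg])
  define \<tau> where "\<tau> = b / a"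
  have \<tau>: "0 \<le> \<tau>" using a b by (simp add: \<tau>_def)

  \<comment> \<open>Both sides of the equation as measures on the whole space: \<open>\<psi>(u) \<mu>\<close>, and \<open>\<tau>\<close> times the image of
    \<open>r G\<^sub>z(r, \<xi>) \<kappa>\<close> under \<open>\<alpha>\<close>.\<close>
  define M where "M = distr (density \<mu> (\<lambda>x. ennreal (h x))) borel (\<lambda>x. x)"
  define N where "N = distr (density \<kappa> (\<lambda>\<xi>. ennreal (\<tau> * f \<xi>))) borel \<alpha>"
  have id_meas: "(\<lambda>x. x) \<in> borel_measurable (density \<mu> (\<lambda>x. ennreal (h x)))"
    using sphere_measurable_ident[OF sets\<mu>] by simp
  have \<alpha>_meas: "\<alpha> \<in> borel_measurable (density \<kappa> (\<lambda>\<xi>. ennreal (\<tau> * f \<xi>)))"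
    using \<alpha>(1) by simp
  have M_emeasure: "emeasure M \<omega> = (\<integral>\<^sup>+x. ennreal (h x) * indicator \<omega> x \<partial>\<mu>)" if "\<omega> \<in> sets borel" for \<omega>
  proof -
    have "emeasure M \<omega> = emeasure (density \<mu> (\<lambda>x. ennreal (h x))) (\<omega> \<inter> sphere 0 1)"
      unfolding M_def using emeasure_distr[OF id_meas that] by (simp add: sp\<mu>)
    also have "\<dots> = (\<integral>\<^sup>+x. ennreal (h x) * indicator (\<omega> \<inter> sphere 0 1) x \<partial>\<mu>)"
    proof (rule emeasure_density)
      show "(\<lambda>x. ennreal (h x)) \<in> borel_measurable \<mu>"
        using borel_measurable_integrable[OF int_h] by simp
      show "\<omega> \<inter> sphere 0 1 \<in> sets \<mu>"
        using that unfolding sphere_borel_subset_iff[OF sets\<mu>] by auto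
    qed
    also have "\<dots> = (\<integral>\<^sup>+x. ennreal (h x) * indicator \<omega> x \<partial>\<mu>)"
      by (rule nn_integral_cong) (auto simp: sp\<mu> indicator_def)
    finally show ?thesis .
  qed
  have N_emeasure: "emeasure N \<omega> = ennreal \<tau> * (\<integral>\<^sup>+\<xi>. ennreal (f \<xi>) * indicator \<omega> (\<alpha> \<xi>) \<partial>\<kappa>)"
    if "\<omega> \<in> sets borel" for \<omega>
  proof -
    have "emeasure N \<omega> = emeasure (density \<kappa> (\<lambda>\<xi>. ennreal (\<tau> * f \<xi>))) (\<alpha> -` \<omega> \<inter> space \<kappa>)"
      unfolding N_def using emeasure_distr[OF \<alpha>_meas that] by simp
    also have "\<dots> = (\<integral>\<^sup>+\<xi>. ennreal (\<tau> * f \<xi>) * indicator (\<alpha> -` \<omega> \<inter> space \<kappa>) \<xi> \<partial>\<kappa>)"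
      using borel_measurable_integrable[OF int_f] measurable_sets[OF \<alpha>(1) that]
      by (intro emeasure_density) auto
    also have "\<dots> = (\<integral>\<^sup>+\<xi>. ennreal \<tau> * (ennreal (f \<xi>) * indicator \<omega> (\<alpha> \<xi>)) \<partial>\<kappa>)"
      by (rule nn_integral_cong) (use \<tau> in \<open>auto simp: indicator_def ennreal_mult'\<close>)
    also have "\<dots> = ennreal \<tau> * (\<integral>\<^sup>+\<xi>. ennreal (f \<xi>) * indicator \<omega> (\<alpha> \<xi>) \<partial>\<kappa>)"
    proof (rule nn_integral_cmult)
      have "(\<lambda>\<xi>. indicator \<omega> (\<alpha> \<xi>) :: ennreal) \<in> borel_measurable \<kappa>"
        using \<alpha>(1) borel_measurable_indicator[OF that] by (rule measurable_compose)
      then show "(\<lambda>\<xi>. ennreal (f \<xi>) * indicator \<omega> (\<alpha> \<xi>)) \<in> borel_measurable \<kappa>"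
        using borel_measurable_integrable[OF int_f] by simp
    qed
    finally show ?thesis .
  qed
  have nn_f: "(\<integral>\<^sup>+\<xi>. ennreal (f \<xi>) \<partial>\<kappa>) = ennreal a" and nn_h: "(\<integral>\<^sup>+x. ennreal (h x) \<partial>\<mu>) = ennreal b"
    unfolding a_def b_def using int_f f_nonneg int_h h_nonneg by (simp_all add: nn_integral_eq_integral)
  have "M = N"
  proof (rule borel_measure_eqI_continuous)
    show "sets M = sets borel" "sets N = sets borel" by (simp_all add: M_def N_def)
    have "emeasure M UNIV = ennreal b" using M_emeasure[of UNIV] by (simp add: nn_h)
    then show "finite_measure M" by (intro finite_measureI) (simp add: M_def)
    have "emeasure N UNIV = ennreal \<tau> * ennreal a" using N_emeasure[of UNIV] by (simp add: nn_f)
    then show "finite_measure N" by (intro finite_measureI) (simp add: N_def ennreal_mult_eq_top_iff)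
  next
    fix \<phi> :: "'a \<Rightarrow> real" assume \<phi>: "continuous_on UNIV \<phi>"
    note \<phi>_meas = borel_measurable_continuous_onI[OF \<phi>]
    have EL: "energy_variation \<Psi> \<mu> K \<phi> = b / a * volume_variation G \<kappa> K \<alpha> \<phi>"
      unfolding a1 b1
      by (rule euler_lagrange_equation[OF G \<Psi> \<kappa> \<mu> K min \<alpha> a[unfolded a1] \<phi>])
    have "(\<integral>x. \<phi> x \<partial>M) = (\<integral>x. h x * \<phi> x \<partial>\<mu>)"
    proof -
      have "\<phi> \<in> borel_measurable \<mu>"
        by (rule measurable_on_sphere[OF sets\<mu> continuous_on_subset[OF \<phi>]]) simp
      then show ?thesis
        unfolding M_def using integral_distr[OF id_meas \<phi>_meas] borel_measurable_integrable[OF int_h] h_nonneg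
        by (simp add: integral_density)
    qed
    also have "\<dots> = \<tau> * (\<integral>\<xi>. f \<xi> * \<phi> (\<alpha> \<xi>) \<partial>\<kappa>)"
      using EL by (simp add: \<tau>_def volume_variation_def energy_variation_def f_def h_def)
    also have "\<dots> = (\<integral>x. \<phi> x \<partial>N)"
    proof -
      have "(\<lambda>\<xi>. \<phi> (\<alpha> \<xi>)) \<in> borel_measurable \<kappa>"
        using \<alpha>(1) \<phi>_meas by (rule measurable_compose)
      moreover have "AE \<xi> in \<kappa>. 0 \<le> \<tau> * f \<xi>"
        using f_nonneg by eventually_elim (simp add: \<tau>)
      ultimately show ?thesis
        unfolding N_def using integral_distr[OF \<alpha>_meas \<phi>_meas] borel_measurable_integrable[OF int_f]
        by (simp add: integral_density mult.assoc)
    qed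
    finally show "(\<integral>x. \<phi> x \<partial>M) = (\<integral>x. \<phi> x \<partial>N)" .
  qed
  have curvature: "dual_curvature G \<kappa> K \<omega> = (\<integral>\<^sup>+\<xi>. ennreal (f \<xi>) * indicator \<omega> (\<alpha> \<xi>) \<partial>\<kappa>)"
    if "\<omega> \<subseteq> sphere 0 1" for \<omega>
    unfolding f_def by (rule dual_curvature_eq[OF \<kappa> K(1,3) \<alpha>(3) that])
  have total: "dual_curvature G \<kappa> K (sphere 0 1) = ennreal a"
    using curvature[of "sphere 0 1"] \<alpha>(2) by (simp add: nn_f)
  show ?thesis
  proof (intro bexI exI conjI ballI)
    show "K \<in> bodies_with_origin"
      using K int by (simp add: bodies_with_origin_def convex_body_def)
    show "dual_curvature G \<kappa> K (sphere 0 1) \<notin> {0, \<infinity>}"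
      using a by (simp add: total)
    show "ennreal \<tau> = (\<integral>\<^sup>+ x. ennreal (\<psi> (?u x) x) \<partial>\<mu>) / dual_curvature G \<kappa> K (sphere 0 1)"
      using a b nn_h by (simp add: total \<tau>_def assms(3) h_def divide_ennreal)
    fix \<omega> assume "\<omega> \<in> sets (restrict_space borel (sphere (0::'a) 1))"
    then have \<omega>: "\<omega> \<in> sets borel" "\<omega> \<subseteq> sphere 0 1"
      using sphere_borel_subset_iff[OF refl, of \<omega>] by blast+
    show "(\<integral>\<^sup>+ x \<in> \<omega>. ennreal (\<psi> (?u x) x) \<partial>\<mu>) = ennreal \<tau> * dual_curvature G \<kappa> K \<omega>"
      using M_emeasure[OF \<omega>(1)] N_emeasure[OF \<omega>(1)] \<open>M = N\<close>
      by (simp add: curvature[OF \<omega>(2)] assms(3) h_def)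
  qed
qed

end
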